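(* Let $u,p$ be smooth on a time interval (times $\mathbb T^3$), with $\operatorname{div}u=0$ and with the spatial mean of $u$ fixed in time, and let $B(t,x)\in\mathbb S^3$ be smooth. Set $A=e^B$ and define $$\mathcal S[u,B]=\partial_tA+u\cdot\nabla A-\nabla u\,A-A(\nabla u)^T+\lambda^{-1}(A-I)$$ (which takes values in $\mathbb S^3$), $$\mathcal N[u,B]=\partial_tu+\operatorname{div}(u\otimes u)-\nu\Delta u-\alpha\operatorname{div}(A-I)$$ (which has zero spatial mean), $R_{\mathcal N}=\mathcal A\,\mathcal N[u,B]$ with $\mathcal A$ the canonical symmetric trace-free anti-divergence, and $$P(t)=\int_{\mathbb T^3}-R_{\mathcal N}(t):D(u(t))\,dx,\qquad G(t)=I-A(t)^{-1}.$$ (i) If the residual-matching Reynolds state associated with $(u,p,B)$ is energy--entropy admissible, then for a.e. $t$, $$[P(t)]_+\le\frac{\alpha}{2}\|G(t)\|_{L^2}\,\|\mathcal S[u,B](t)\|_{L^2}.$$ (ii) When $G(t)\not\equiv0$, the smallest $L^2$-size $\|S(t,\cdot)\|_{L^2}$ among all candidate defects $S(t,\cdot)\in L^2(\mathbb T^3;\mathbb S^3)$ satisfying $$P(t)+\frac{\alpha}{2}\int_{\mathbb T^3}G(t):S(t)\,dx\le0$$ is $$\frac{2[P(t)]_+}{\alpha\|G(t)\|_{L^2}},$$ and, if $P(t)>0$, the unique minimizer in this problem is the symmetric field $$S_{\min}(t,x)=-\frac{2P(t)}{\alpha\|G(t)\|_{L^2}^2}\,G(t,x).$$ Thus, whenever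 admissible, the actual residual $\mathcal S[u,B](t)$ must satisfy $\|\mathcal S[u,B](t)\|_{L^2}\ge 2[P(t)]_+/(\alpha\|G(t)\|_{L^2})$. (iii) If $G(t)\equiv0$, equivalently $A(t)=I$ a.e., admissibility forces $P(t)\le0$. (Consequences of admissibility at individual times are understood for a.e. $t$, as in the definition of admissibility.)
   Context: $\mathbb T^3$ is the flat periodic three-torus (Fourier modes $k\in\mathbb Z^3$); $\mathbb S^3$ is the space of real symmetric $3\times3$ matrices; $I$ is the identity; $M:N=\operatorname{tr}(MN^T)$ is the Frobenius product, and $L^2$ norms of matrix fields over $\mathbb T^3$ use it. $(\nabla u)_{ij}=\partial_ju_i$, $D(u)=\frac12(\nabla u+(\nabla u)^T)$, divergence of matrix fields acts row-wise. $[x]_+=\max(x,0)$. $\nu,\alpha,\lambda>0$ are fixed parameters. Anti-divergence $\mathcal A$: for a smooth zero-mean vector field $m$ on $\mathbb T^3$, let $\phi$ be the unique zero-mean solution of $\Delta\phi+\frac13\nabla\operatorname{div}\phi=m$, and set $(\mathcal Am)_{ij}=\partial_i\phi_j+\partial_j\phi_i-\frac23\delta_{ij}\operatorname{div}\phi$. Then $\mathcal Am$ is smooth, symmetric, trace free, of zero mean, and $\operatorname{div}(\mathcal Am)=m$. A positive-cone Oldroyd--B Reynolds state is a tuple $(u,p,B,R,S)$ with $R,S,B\in\mathbb S^3$, $A=e^B$, $\operatorname{div}u=0$, satisfying $$\partial_tu+\operatorname{div}(u\otimes u)-\nu\Delta u+\nabla p=\alpha\operatorname{div}(A-I)+\operatorname{div}R,$$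 $$\partial_tA+u\cdot\nabla A-\nabla u\,A-A(\nabla u)^T+\lambda^{-1}(A-I)=S.$$ It is energy--entropy admissible on a time interval if $\int_{\mathbb T^3}\big[-R:D(u)+\frac{\alpha}{2}(I-A^{-1}):S\big]dx\le0$ for a.e. $t$. The residual-matching Reynolds state associated with $(u,p,B)$ is the one with $S=\mathcal S[u,B]$ and $R=R_{\mathcal N}+p\,I$ (momentum defect represented by $R_{\mathcal N}$ modulo the pressure tensor, which does no work since $\operatorname{div}u=0$); its admissibility is thus equivalent to $\int_{\mathbb T^3}\big[-R_{\mathcal N}:D(u)+\frac{\alpha}{2}(I-A^{-1}):\mathcal S[u,B]\big]dx\le0$ for a.e. $t$. *)

theory Defs
  imports "HOL-Analysis.Analysis"
begin

section \<open>Smooth functions\<close>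

text \<open>
  All derivatives are taken within the set, so that for \<open>S = J \<times> UNIV\<close> with a time interval \<open>J\<close>
  containing an end point the time derivatives there are one-sided. On such sets (convex, with
  nonempty interior) the Frechet derivative within \<open>S\<close> is unique.
\<close>

primrec C_k_on :: "nat \<Rightarrow> 'a::real_normed_vector set \<Rightarrow> ('a \<Rightarrow> 'b::real_normed_vector) \<Rightarrow> bool" where
  "C_k_on 0 S f \<longleftrightarrow> continuous_on S f"
| "C_k_on (Suc k) S f \<longleftrightarrow> f differentiable_on S \<and>
     (\<forall>v. C_k_on k S (\<lambda>x. frechet_derivative f (at x within S) v))"

definition smooth_on :: "'a::real_normed_vector set \<Rightarrow> ('a \<Rightarrow> 'b::real_normed_vector) \<Rightarrow> bool" where
  "smooth_on S f \<longleftrightarrow> (\<forall>k. C_k_on k S f)"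


section \<open>The periodic torus\<close>

text \<open>
  Fields on the torus are functions on \<open>\<real>\<^sup>3\<close> that are periodic with period \<open>L\<close> in each coordinate;
  \<open>L = 1\<close> and \<open>L = 2 * pi\<close> are the two usual normalisations. Integrals are over one
  period cell; the faces of the closed cell are a null set, so nothing is counted twice.
\<close>

definition periodic :: "real \<Rightarrow> (real ^ 3 \<Rightarrow> 'b) \<Rightarrow> bool" where
  "periodic L f \<longleftrightarrow> (\<forall>x i. f (x + L *\<^sub>R axis i 1) = f x)"

definition torus :: "real \<Rightarrow> (real ^ 3) measure" where
  "torus L = lebesgue_on (cbox 0 (\<chi> i. L))"

definition torus_mean :: "real \<Rightarrow> (real ^ 3 \<Rightarrow> 'b::{banach, second_countable_topology}) \<Rightarrow> 'b" where
  "torus_mean L f = (1 / L ^ 3) *\<^sub>R (LINT x|torus L. f x)"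


section \<open>Matrices\<close>

definition frob :: "real ^ 3 ^ 3 \<Rightarrow> real ^ 3 ^ 3 \<Rightarrow> real"  (infixl \<open>:\<^sub>F\<close> 70) where
  "M :\<^sub>F N = trace (M ** transpose N)"

definition symmetric :: "real ^ 3 ^ 3 \<Rightarrow> bool" where
  "symmetric M \<longleftrightarrow> transpose M = M"

text \<open>The library's \<open>exp\<close> is not available on \<open>real ^ 3 ^ 3\<close>, where \<open>*\<close> is not the matrix product.\<close>

definition mexp :: "real ^ 3 ^ 3 \<Rightarrow> real ^ 3 ^ 3" where
  "mexp M = (\<Sum>n. (1 / fact n) *\<^sub>R (((**) M ^^ n) (mat 1)))"

definition L2_norm :: "real \<Rightarrow> (real ^ 3 \<Rightarrow> real ^ 3 ^ 3) \<Rightarrow> real" where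
  "L2_norm L M = sqrt (LINT x|torus L. M x :\<^sub>F M x)"

text \<open>Representatives of elements of \<open>L\<^sup>2\<close> with values in the symmetric matrices.\<close>

definition L2_sym :: "real \<Rightarrow> (real ^ 3 \<Rightarrow> real ^ 3 ^ 3) set" where
  "L2_sym L = {M. M \<in> borel_measurable (torus L) \<and> integrable (torus L) (\<lambda>x. M x :\<^sub>F M x) \<and>
                  (AE x in torus L. symmetric (M x))}"


section \<open>Spatial and temporal differential operators\<close>

definition partial :: "3 \<Rightarrow> (real ^ 3 \<Rightarrow> 'b::real_normed_vector) \<Rightarrow> real ^ 3 \<Rightarrow> 'b" where
  "partial i f x = frechet_derivative f (at x) (axis i 1)"

definition grad :: "(real ^ 3 \<Rightarrow> real) \<Rightarrow> real ^ 3 \<Rightarrow> real ^ 3" where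
  "grad f x = (\<chi> i. partial i f x)"

definition nabla :: "(real ^ 3 \<Rightarrow> real ^ 3) \<Rightarrow> real ^ 3 \<Rightarrow> real ^ 3 ^ 3" where
  "nabla v x = (\<chi> i j. partial j v x $ i)"

definition symgrad :: "(real ^ 3 \<Rightarrow> real ^ 3) \<Rightarrow> real ^ 3 \<Rightarrow> real ^ 3 ^ 3" where
  "symgrad v x = (1 / 2) *\<^sub>R (nabla v x + transpose (nabla v x))"

definition divergence :: "(real ^ 3 \<Rightarrow> real ^ 3) \<Rightarrow> real ^ 3 \<Rightarrow> real" where
  "divergence v x = (\<Sum>i\<in>UNIV. partial i v x $ i)"

definition mat_divergence :: "(real ^ 3 \<Rightarrow> real ^ 3 ^ 3) \<Rightarrow> real ^ 3 \<Rightarrow> real ^ 3" where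
  "mat_divergence M x = (\<chi> i. \<Sum>j\<in>UNIV. partial j M x $ i $ j)"

definition laplacian :: "(real ^ 3 \<Rightarrow> real ^ 3) \<Rightarrow> real ^ 3 \<Rightarrow> real ^ 3" where
  "laplacian v x = (\<Sum>i\<in>UNIV. partial i (partial i v) x)"

definition advect :: "(real ^ 3 \<Rightarrow> real ^ 3) \<Rightarrow> (real ^ 3 \<Rightarrow> real ^ 3 ^ 3) \<Rightarrow> real ^ 3 \<Rightarrow> real ^ 3 ^ 3" where
  "advect v M x = (\<Sum>k\<in>UNIV. v x $ k *\<^sub>R partial k M x)"

definition outer :: "real ^ 3 \<Rightarrow> real ^ 3 \<Rightarrow> real ^ 3 ^ 3" where
  "outer v w = (\<chi> i j. v $ i * w $ j)"

definition time_deriv :: "real set \<Rightarrow> (real \<Rightarrow> real ^ 3 \<Rightarrow> 'b::real_normed_vector) \<Rightarrow> real \<Rightarrow> real ^ 3 \<Rightarrow> 'b" where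
  "time_deriv J f t x = vector_derivative (\<lambda>s. f s x) (at t within J)"


section \<open>The canonical anti-divergence\<close>

definition lame_potential :: "real \<Rightarrow> (real ^ 3 \<Rightarrow> real ^ 3) \<Rightarrow> real ^ 3 \<Rightarrow> real ^ 3" where
  "lame_potential L m = (THE \<phi>. smooth_on UNIV \<phi> \<and> periodic L \<phi> \<and> torus_mean L \<phi> = 0 \<and>
     (\<forall>x. laplacian \<phi> x + (1 / 3) *\<^sub>R grad (divergence \<phi>) x = m x))"

definition antidiv :: "real \<Rightarrow> (real ^ 3 \<Rightarrow> real ^ 3) \<Rightarrow> real ^ 3 \<Rightarrow> real ^ 3 ^ 3" where
  "antidiv L m x = (let \<phi> = lame_potential L m in
     (\<chi> i j. partial i \<phi> x $ j + partial j \<phi> x $ i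
             - 2 / 3 * (if i = j then 1 else 0) * divergence \<phi> x))"


section \<open>Oldroyd--B residuals and admissibility\<close>

definition stress_residual ::
  "real set \<Rightarrow> real \<Rightarrow> (real \<Rightarrow> real ^ 3 \<Rightarrow> real ^ 3) \<Rightarrow> (real \<Rightarrow> real ^ 3 \<Rightarrow> real ^ 3 ^ 3)
    \<Rightarrow> real \<Rightarrow> real ^ 3 \<Rightarrow> real ^ 3 ^ 3" where
  "stress_residual J lam u B t x = (let A = (\<lambda>s y. mexp (B s y)) in
     time_deriv J A t x + advect (u t) (A t) x
     - nabla (u t) x ** A t x - A t x ** transpose (nabla (u t) x)
     + inverse lam *\<^sub>R (A t x - mat 1))"

definition momentum_residual ::
  "real set \<Rightarrow> real \<Rightarrow> real \<Rightarrow> (real \<Rightarrow> real ^ 3 \<Rightarrow> real ^ 3) \<Rightarrow> (real \<Rightarrow> real ^ 3 \<Rightarrow> real ^ 3 ^ 3)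
    \<Rightarrow> real \<Rightarrow> real ^ 3 \<Rightarrow> real ^ 3" where
  "momentum_residual J \<nu> \<alpha> u B t x =
     time_deriv J u t x + mat_divergence (\<lambda>y. outer (u t y) (u t y)) x
     - \<nu> *\<^sub>R laplacian (u t) x - \<alpha> *\<^sub>R mat_divergence (\<lambda>y. mexp (B t y) - mat 1) x"

text \<open>
  The energy--entropy inequality for a tuple \<open>(u, p, B, R, S)\<close>; the pressure does not enter. For the
  residual-matching tuple, \<open>R = antidiv L N + p I\<close> and \<open>S = stress_residual\<close>, the two evolution
  equations of a Reynolds state hold by the choice of \<open>R\<close> and \<open>S\<close>, so they are not made part of this
  predicate.
\<close>

definition energy_entropy_admissible ::
  "real \<Rightarrow> real set \<Rightarrow> real \<Rightarrow> (real \<Rightarrow> real ^ 3 \<Rightarrow> real ^ 3) \<Rightarrow> (real \<Rightarrow> real ^ 3 \<Rightarrow> real ^ 3 ^ 3)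
    \<Rightarrow> (real \<Rightarrow> real ^ 3 \<Rightarrow> real ^ 3 ^ 3) \<Rightarrow> (real \<Rightarrow> real ^ 3 \<Rightarrow> real ^ 3 ^ 3) \<Rightarrow> bool" where
  "energy_entropy_admissible L J \<alpha> u B R S \<longleftrightarrow>
     (AE t in lebesgue. t \<in> J \<longrightarrow>
        (LINT x|torus L. - (R t x :\<^sub>F symgrad (u t) x)
            + \<alpha> / 2 * ((mat 1 - matrix_inv (mexp (B t x))) :\<^sub>F S t x)) \<le> 0)"

definition residual_matching_admissible ::
  "real \<Rightarrow> real set \<Rightarrow> real \<Rightarrow> real \<Rightarrow> real \<Rightarrow> (real \<Rightarrow> real ^ 3 \<Rightarrow> real ^ 3) \<Rightarrow> (real \<Rightarrow> real ^ 3 \<Rightarrow> real)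
    \<Rightarrow> (real \<Rightarrow> real ^ 3 \<Rightarrow> real ^ 3 ^ 3) \<Rightarrow> bool" where
  "residual_matching_admissible L J \<nu> \<alpha> lam u p B \<longleftrightarrow>
     energy_entropy_admissible L J \<alpha> u B
       (\<lambda>t x. antidiv L (momentum_residual J \<nu> \<alpha> u B t) x + p t x *\<^sub>R mat 1)
       (stress_residual J lam u B)"

definition candidate_defects :: "real \<Rightarrow> real \<Rightarrow> real \<Rightarrow> (real ^ 3 \<Rightarrow> real ^ 3 ^ 3) \<Rightarrow> (real ^ 3 \<Rightarrow> real ^ 3 ^ 3) set" where
  "candidate_defects L \<alpha> P G =
     {S \<in> L2_sym L. P + \<alpha> / 2 * (LINT x|torus L. G x :\<^sub>F S x) \<le> 0}"

end

theory Submission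
  imports Defs
begin

text \<open>
  At a fixed time the problem is Hilbert space geometry. Let \<open>G \<noteq> 0\<close>. The defects \<open>T\<close> with
  \<open>P + \<alpha>/2 \<langle>G, T\<rangle> \<le> 0\<close> form a closed half-space of \<open>L\<^sup>2\<close> with normal \<open>G\<close>. For \<open>P > 0\<close> it misses the origin,
  its nearest point is the multiple \<open>- c G\<close> of the normal that satisfies the inequality with equality,
  and an inequality of Pythagoras, \<open>\<parallel>T + c G\<parallel>\<^sup>2 + \<parallel>c G\<parallel>\<^sup>2 \<le> \<parallel>T\<parallel>\<^sup>2\<close> (lemma \<open>candidate_defect_pythagoras\<close>), gives
  the minimal norm and the uniqueness of the minimiser at once. For \<open>P \<le> 0\<close> the zero defect is a candidate.

  Admissibility enters only through \<open>admissible_imp_candidate_defect\<close>: since the pressure tensor does no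
  work on a divergence-free velocity, admissibility at time \<open>t\<close> says that the actual residual \<open>S t\<close> is
  one of the candidates, unless \<open>P t = 0\<close>. The norm bounds for candidates then become bounds for
  \<open>S t\<close>; when \<open>G t = 0\<close> they degenerate to \<open>P t \<le> 0\<close>.

  To apply this, \<open>G t\<close> and \<open>S t\<close> have to be continuous, symmetric fields. This rests on the
  continuous differentiability of the matrix exponential, obtained by differentiating its series term by term
  (\<open>mexp_C1\<close>), and on \<open>matrix_inv_mexp\<close>, which turns \<open>A\<^sup>-\<^sup>1\<close> into the exponential of \<open>- B\<close>.
  A continuous periodic field whose \<open>L\<^sup>2\<close> norm vanishes is zero everywhere, so \<open>G t \<noteq> 0\<close> at a single point
  makes the norm of \<open>G t\<close> positive.

  The momentum residual has zero mean because the mean of \<open>u\<close> does not change in time and all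
  remaining terms are sums of first partial derivatives of periodic fields. Such derivatives integrate to zero over a period
  cell because the integral of a periodic field is invariant under translations
  (\<open>integral_directional_derivative_eq_0\<close>).
\<close>

section \<open>Continuously differentiable maps\<close>

text \<open>
  The derivative \<open>D\<close> is carried explicitly instead of being recovered by
  \<open>frechet_derivative\<close>: the chain rule then gives the derivative of a composition without
  any appeal to uniqueness of derivatives within \<open>X\<close>. Continuity of \<open>D\<close> is asked for each fixed
  direction, which in finite dimension is continuity in the operator norm.
\<close>
definition C1_within :: "'a::real_normed_vector set \<Rightarrow> ('a \<Rightarrow> 'b::real_normed_vector) \<Rightarrow> ('a \<Rightarrow> 'a \<Rightarrow> 'b) \<Rightarrow> bool" where
  "C1_within X f D \<longleftrightarrow>
     (\<forall>z\<in>X. (f has_derivative D z) (at z within X)) \<and> (\<forall>v. continuous_on X (\<lambda>z. D z v))"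

lemma C1_withinD:
  assumes "C1_within X f D"
  shows "z \<in> X \<Longrightarrow> (f has_derivative D z) (at z within X)"
    and "continuous_on X (\<lambda>z. D z v)" and "continuous_on X f"
  using assms by (auto simp: C1_within_def intro: has_derivative_continuous_on)

lemma C_k_on_Suc_imp_C1_within:
  assumes "C_k_on (Suc k) X f"
  shows "C1_within X f (\<lambda>z. frechet_derivative f (at z within X))"
proof -
  have diff: "f differentiable (at z within X)" if "z \<in> X" for z
    using assms that by (auto simp: differentiable_on_def)
  have "C_k_on k X g \<Longrightarrow> continuous_on X g" for g :: "'a \<Rightarrow> 'b"
    by (cases k) (auto intro: differentiable_imp_continuous_on)
  then show ?thesis
    using assms diff by (auto simp: C1_within_def frechet_derivative_works)
qed

lemma smooth_on_C1_within:
  assumes "smooth_on X f"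
  shows "C1_within X f (\<lambda>z. frechet_derivative f (at z within X))"
  using assms C_k_on_Suc_imp_C1_within[of 0] unfolding smooth_on_def by blast

lemma smooth_on_derivative_C1_within:
  assumes "smooth_on X f"
  shows "\<exists>D2. C1_within X (\<lambda>z. frechet_derivative f (at z within X) v) D2"
proof -
  have "C_k_on (Suc (Suc 0)) X f" using assms unfolding smooth_on_def by blast
  then have "C_k_on (Suc 0) X (\<lambda>z. frechet_derivative f (at z within X) v)"
    by (simp only: C_k_on.simps(2)[of "Suc 0"])
  then show ?thesis using C_k_on_Suc_imp_C1_within by blast
qed

text \<open>
  Continuity of \<open>Dg (f z) (Df z v)\<close> involves a direction that moves with \<open>z\<close>; expanding it
  in the basis reduces this to the fixed directions in the definition.
\<close>
lemma C1_within_compose: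
  fixes f :: "'a::real_normed_vector \<Rightarrow> 'b::euclidean_space" and g :: "'b \<Rightarrow> 'c::real_normed_vector"
  assumes f: "C1_within X f Df" and g: "C1_within UNIV g Dg"
  shows "C1_within X (\<lambda>z. g (f z)) (\<lambda>z v. Dg (f z) (Df z v))"
  unfolding C1_within_def
proof (intro conjI ballI allI)
  fix z assume "z \<in> X"
  then show "((\<lambda>z. g (f z)) has_derivative (\<lambda>v. Dg (f z) (Df z v))) (at z within X)"
    using C1_withinD(1)[OF f] C1_withinD(1)[OF g]
    by (auto intro: has_derivative_compose)
next
  fix v
  have *: "Dg y h = (\<Sum>b\<in>Basis. (h \<bullet> b) *\<^sub>R Dg y b)" for y h
  proof -
    have "linear (Dg y)"
      using C1_withinD(1)[OF g, of y] by (auto dest: has_derivative_linear)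
    then have "Dg y (\<Sum>b\<in>Basis. (h \<bullet> b) *\<^sub>R b) = (\<Sum>b\<in>Basis. (h \<bullet> b) *\<^sub>R Dg y b)"
      by (simp add: linear_sum linear_scale)
    then show ?thesis by (simp add: euclidean_representation)
  qed
  have "continuous_on X (\<lambda>z. Dg (f z) b)" for b
    using continuous_on_compose2[OF C1_withinD(2)[OF g] C1_withinD(3)[OF f]] by auto
  then show "continuous_on X (\<lambda>z. Dg (f z) (Df z v))"
    by (subst *) (intro continuous_intros C1_withinD(2)[OF f])
qed

lemma C1_within_bilinear:
  assumes "bounded_bilinear bop" and f: "C1_within X f Df" and g: "C1_within X g Dg"
  shows "C1_within X (\<lambda>z. bop (f z) (g z)) (\<lambda>z v. bop (f z) (Dg z v) + bop (Df z v) (g z))"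
  unfolding C1_within_def
proof (intro conjI ballI allI)
  fix z assume "z \<in> X"
  then show "((\<lambda>z. bop (f z) (g z)) has_derivative (\<lambda>v. bop (f z) (Dg z v) + bop (Df z v) (g z))) (at z within X)"
    by (intro bounded_bilinear.FDERIV[OF assms(1)] C1_withinD(1)[OF f] C1_withinD(1)[OF g])
next
  fix v
  show "continuous_on X (\<lambda>z. bop (f z) (Dg z v) + bop (Df z v) (g z))"
    by (intro continuous_on_add bounded_bilinear.continuous_on[OF assms(1)]
        C1_withinD(2,3)[OF f] C1_withinD(2,3)[OF g])
qed

lemma C1_within_diff_const:
  assumes "C1_within X f D"
  shows "C1_within X (\<lambda>z. f z - c) D"
proof -
  have "((\<lambda>z. f z - c) has_derivative D z) (at z within X)" if "z \<in> X" for z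
    using has_derivative_diff[OF C1_withinD(1)[OF assms that] has_derivative_const] by simp
  then show ?thesis
    using C1_withinD(2)[OF assms] by (simp add: C1_within_def)
qed

section \<open>Matrix multiplication, transposition and symmetry\<close>

lemma bounded_bilinear_matrix_mult: "bounded_bilinear ((**) :: real^'n^'m \<Rightarrow> real^'p^'n \<Rightarrow> real^'p^'m)"
  by (rule bilinear_conv_bounded_bilinear[THEN iffD1])
    (auto simp: bilinear_def linear_iff matrix_matrix_mult_def vec_eq_iff
      sum.distrib sum_distrib_left algebra_simps)

interpretation mm: bounded_bilinear "(**) :: real^3^3 \<Rightarrow> real^3^3 \<Rightarrow> real^3^3"
  by (rule bounded_bilinear_matrix_mult)

lemma bounded_linear_transpose: "bounded_linear (transpose :: real^'n^'m \<Rightarrow> real^'m^'n)"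
  by (rule linear_conv_bounded_linear[THEN iffD1])
    (auto simp: linear_iff transpose_def vec_eq_iff)

lemma symmetric_add: "symmetric M \<Longrightarrow> symmetric N \<Longrightarrow> symmetric (M + N)"
  and symmetric_diff: "symmetric M \<Longrightarrow> symmetric N \<Longrightarrow> symmetric (M - N)"
  and symmetric_scaleR: "symmetric M \<Longrightarrow> symmetric (r *\<^sub>R M)"
  and symmetric_mat: "symmetric (mat r)"
  by (simp_all add: symmetric_def bounded_linear.linear[OF bounded_linear_transpose]
      linear_add linear_diff linear_scale transpose_mat)

lemma symmetric_sum: "(\<And>i. i \<in> I \<Longrightarrow> symmetric (f i)) \<Longrightarrow> symmetric (\<Sum>i\<in>I. f i)"
  by (simp add: symmetric_def linear_sum[OF bounded_linear.linear[OF bounded_linear_transpose]])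

section \<open>The matrix exponential\<close>

abbreviation mpow :: "nat \<Rightarrow> real^3^3 \<Rightarrow> real^3^3" where
  "mpow n M \<equiv> ((**) M ^^ n) (mat 1)"

text \<open>
  The derivative of the power \<open>M ^ n\<close> in direction \<open>H\<close>, that is the sum of \<open>M ^ i ** H ** M ^ j\<close>
  over \<open>i + j = n - 1\<close>, written as the recursion that the product rule yields.
\<close>
primrec mpow_deriv :: "nat \<Rightarrow> real^3^3 \<Rightarrow> real^3^3 \<Rightarrow> real^3^3" where
  "mpow_deriv 0 M H = 0"
| "mpow_deriv (Suc n) M H = H ** mpow n M + M ** mpow_deriv n M H"

definition mexp_deriv :: "real^3^3 \<Rightarrow> real^3^3 \<Rightarrow> real^3^3" where
  "mexp_deriv M H = (\<Sum>n. (1 / fact n) *\<^sub>R mpow_deriv n M H)"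

lemma mpow_has_derivative: "(mpow n has_derivative mpow_deriv n M) (at M within X)"
proof (induction n)
  case 0
  then show ?case by simp
next
  case (Suc n)
  show ?case
    using mm.FDERIV[OF has_derivative_ident Suc] by (simp add: add.commute)
qed

lemma continuous_on_mpow [continuous_intros]: "continuous_on X (mpow n)"
  using has_derivative_continuous_on mpow_has_derivative by blast

lemma continuous_on_mpow_deriv [continuous_intros]: "continuous_on X (\<lambda>M. mpow_deriv n M H)"
proof (induction n)
  case (Suc n)
  show ?case
    unfolding mpow_deriv.simps
    by (intro continuous_on_add mm.continuous_on continuous_on_const continuous_on_id continuous_on_mpow Suc)
qed simp

text \<open>
  Geometric bounds, uniform on balls, for the terms of the exponential series and of its
  termwise derivative. Divided by factorials they are summable, which is all that the
  Weierstrass test needs. The choice \<open>q = K * (r + 1)\<close>, with \<open>K\<close> a bound for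
  the matrix product, makes the recursion for \<open>mpow_deriv\<close> close up exactly.
\<close>
lemma mpow_bounds:
  assumes "0 \<le> r"
  obtains c q where "0 \<le> c" "0 \<le> q" "\<And>M n. norm M \<le> r \<Longrightarrow> norm (mpow n M) \<le> c * q ^ n"
    "\<And>M H n. norm M \<le> r \<Longrightarrow> norm (mpow_deriv n M H) \<le> c * q ^ n * norm H"
proof -
  obtain K where K: "0 \<le> K" "\<And>(a :: real^3^3) (b :: real^3^3). norm (a ** b) \<le> norm a * norm b * K"
    using mm.nonneg_bounded by metis
  define c where "c = norm (mat 1 :: real^3^3)"
  define q where "q = K * (r + 1)"
  have cq: "0 \<le> c" "0 \<le> q" "r * K \<le> q"
    using K assms by (auto simp: c_def q_def algebra_simps)
  have pow: "norm (mpow n M) \<le> c * q ^ n" if "norm M \<le> r" for M n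
  proof (induction n)
    case 0
    then show ?case by (simp add: c_def)
  next
    case (Suc n)
    have "norm (mpow (Suc n) M) \<le> norm M * norm (mpow n M) * K"
      using K(2) by simp
    also have "\<dots> \<le> r * (c * q ^ n) * K"
      using Suc that K(1) assms cq by (intro mult_right_mono mult_mono) auto
    also have "\<dots> = (c * q ^ n) * (r * K)" by simp
    also have "\<dots> \<le> (c * q ^ n) * q"
      using cq by (intro mult_left_mono) auto
    finally show ?case by (simp add: mult_ac)
  qed
  have "norm (mpow_deriv n M H) \<le> c * q ^ n * norm H" if M: "norm M \<le> r" for M H n
  proof (induction n)
    case 0
    then show ?case by (simp add: cq)
  next
    case (Suc n)
    have "norm (mpow_deriv (Suc n) M H) \<le> norm H * norm (mpow n M) * K + norm M * norm (mpow_deriv n M H) * K"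
      using K(2) by (simp add: norm_triangle_le add_mono)
    also have "\<dots> \<le> norm H * (c * q ^ n) * K + r * (c * q ^ n * norm H) * K"
      using Suc M K(1) assms cq pow[OF M, of n] by (intro add_mono mult_right_mono mult_mono) auto
    also have "\<dots> = c * q ^ Suc n * norm H"
      by (simp add: q_def algebra_simps)
    finally show ?case .
  qed
  with pow cq that show thesis by blast
qed

lemma summable_exp_bound: "summable (\<lambda>n. c * q ^ n / fact n :: real)"
  using summable_mult[OF summable_exp, of c q] by (simp add: field_simps)

lemma mexp_sums: "(\<lambda>n. (1 / fact n) *\<^sub>R mpow n M) sums mexp M"
proof -
  obtain c q where "\<And>M' n. norm M' \<le> norm M \<Longrightarrow> norm (mpow n M') \<le> c * q ^ n"
    using mpow_bounds[of "norm M"] norm_ge_zero by metis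
  then have "norm ((1 / fact n) *\<^sub>R mpow n M) \<le> c * q ^ n / fact n" for n
    by (simp add: divide_right_mono)
  then have "summable (\<lambda>n. (1 / fact n) *\<^sub>R mpow n M)"
    by (rule summable_comparison_test'[OF summable_exp_bound, where N = 0])
  then show ?thesis
    unfolding mexp_def by (rule summable_sums)
qed

lemma mexp_deriv_sums: "(\<lambda>n. (1 / fact n) *\<^sub>R mpow_deriv n M H) sums mexp_deriv M H"
proof -
  obtain c q where "\<And>M' H n. norm M' \<le> norm M \<Longrightarrow> norm (mpow_deriv n M' H) \<le> c * q ^ n * norm H"
    using mpow_bounds[of "norm M"] norm_ge_zero by metis
  then have "norm ((1 / fact n) *\<^sub>R mpow_deriv n M H) \<le> (c * norm H) * q ^ n / fact n" for n
    by (simp add: divide_right_mono mult_ac)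
  then have "summable (\<lambda>n. (1 / fact n) *\<^sub>R mpow_deriv n M H)"
    by (rule summable_comparison_test'[OF summable_exp_bound, where N = 0])
  then show ?thesis
    unfolding mexp_deriv_def by (rule summable_sums)
qed

text \<open>
  Termwise differentiation of the exponential series. It requires the differentiated
  series to converge uniformly relative to the size of the direction, so the Weierstrass test is applied
  to the terms divided by \<open>norm H\<close>, jointly in the point and the direction.
\<close>
lemma mexp_has_derivative: "(mexp has_derivative mexp_deriv M) (at M)"
proof -
  define r where "r = norm M + 1"
  have r: "0 \<le> r" "M \<in> ball 0 r" by (auto simp: r_def add_nonneg_nonneg)
  obtain c q where cq: "0 \<le> c" "0 \<le> q"
    "\<And>M H n. norm M \<le> r \<Longrightarrow> norm (mpow_deriv n M H) \<le> c * q ^ n * norm H"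
    using mpow_bounds[OF r(1)] by metis
  let ?d = "\<lambda>n M H. (1 / fact n) *\<^sub>R mpow_deriv n M H"
  \<comment> \<open>For \<open>H = 0\<close> the quotient is \<open>0\<close>, by the convention \<open>1 / 0 = 0\<close>.\<close>
  have bd: "norm ((\<lambda>(M, H). (1 / norm H) *\<^sub>R ?d n M H) z) \<le> c * q ^ n / fact n"
    if "z \<in> ball 0 r \<times> UNIV" for n z
  proof (cases "snd z = 0")
    case True
    then show ?thesis using cq by (simp add: case_prod_beta)
  next
    case False
    then show ?thesis
      using cq(3)[of "fst z" n "snd z"] that by (auto simp: case_prod_beta field_simps)
  qed
  have ul: "uniform_limit (ball 0 r \<times> UNIV) (\<lambda>n z. \<Sum>i<n. (\<lambda>(M, H). (1 / norm H) *\<^sub>R ?d i M H) z)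
              (\<lambda>z. \<Sum>i. (\<lambda>(M, H). (1 / norm H) *\<^sub>R ?d i M H) z) sequentially"
    by (rule Weierstrass_m_test[OF bd summable_exp_bound])
  have ev: "\<forall>\<^sub>F n in sequentially. \<forall>M\<in>ball 0 r. \<forall>h. norm ((\<Sum>i<n. ?d i M h) - mexp_deriv M h) \<le> e * norm h"
    if "e > 0" for e
    using uniform_limitD[OF ul that]
  proof eventually_elim
    case (elim n)
    show ?case
    proof (intro ballI allI)
      fix M' :: "real^3^3" and h assume "M' \<in> ball 0 r"
      then have 1: "dist (\<Sum>i<n. (1 / norm h) *\<^sub>R ?d i M' h) (\<Sum>i. (1 / norm h) *\<^sub>R ?d i M' h) < e"
        using elim by auto
      have 2: "(\<Sum>i. (1 / norm h) *\<^sub>R ?d i M' h) = (1 / norm h) *\<^sub>R mexp_deriv M' h"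
        by (rule sums_unique[symmetric], rule sums_scaleR_right, rule mexp_deriv_sums)
      have 3: "(\<Sum>i<n. (1 / norm h) *\<^sub>R ?d i M' h) = (1 / norm h) *\<^sub>R (\<Sum>i<n. ?d i M' h)"
        by (rule scaleR_sum_right[symmetric])
      have 4: "norm ((\<Sum>i<n. ?d i M' h) - mexp_deriv M' h) / norm h < e"
        using 1 unfolding 2 3 dist_norm scaleR_diff_right[symmetric] by simp
      show "norm ((\<Sum>i<n. ?d i M' h) - mexp_deriv M' h) \<le> e * norm h"
      proof (cases "h = 0")
        case True
        have "mpow_deriv i M' 0 = 0" for i
          by (induction i) (auto simp: mm.zero_left mm.zero_right)
        then show ?thesis using True by (simp add: mexp_deriv_def)
      next
        case False
        with 4 show ?thesis by (simp add: field_simps)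
      qed
    qed
  qed
  have "\<exists>g. \<forall>x\<in>ball 0 r. (\<lambda>n. (1 / fact n) *\<^sub>R mpow n x) sums g x \<and>
          (g has_derivative mexp_deriv x) (at x within ball 0 r)"
    by (rule has_derivative_series[OF _ _ ev r(2) mexp_sums])
      (auto intro: has_derivative_scaleR_right mpow_has_derivative)
  then obtain g where g: "\<And>x. x \<in> ball 0 r \<Longrightarrow> (\<lambda>n. (1 / fact n) *\<^sub>R mpow n x) sums g x"
    "\<And>x. x \<in> ball 0 r \<Longrightarrow> (g has_derivative mexp_deriv x) (at x within ball 0 r)"
    by blast
  have "g x = mexp x" if "x \<in> ball 0 r" for x
    using sums_unique2[OF g(1)[OF that] mexp_sums] .
  then have "(mexp has_derivative mexp_deriv M) (at M within ball 0 r)"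
    using has_derivative_transform[OF r(2) _ g(2)[OF r(2)]] by metis
  then show ?thesis
    using at_within_open[OF r(2)] by simp
qed

lemma mexp_C1: "C1_within UNIV mexp mexp_deriv"
  unfolding C1_within_def
proof (intro conjI ballI allI)
  fix M show "(mexp has_derivative mexp_deriv M) (at M)"
    by (rule mexp_has_derivative)
next
  fix H
  have "isCont (\<lambda>M. mexp_deriv M H) M" for M
  proof -
    define r where "r = norm M + 1"
    have r: "0 \<le> r" "M \<in> ball 0 r" by (auto simp: r_def add_nonneg_nonneg)
    obtain c q where cq: "\<And>M H n. norm M \<le> r \<Longrightarrow> norm (mpow_deriv n M H) \<le> c * q ^ n * norm H"
      using mpow_bounds[OF r(1)] by metis
    have "norm ((1 / fact n) *\<^sub>R mpow_deriv n M' H) \<le> (c * norm H) * q ^ n / fact n"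
      if "M' \<in> ball 0 r" for n M'
      using cq[of M' n H] that by (simp add: divide_right_mono mult_ac)
    then have "uniform_limit (ball 0 r) (\<lambda>n M. \<Sum>i<n. (1 / fact i) *\<^sub>R mpow_deriv i M H)
        (\<lambda>M. mexp_deriv M H) sequentially"
      unfolding mexp_deriv_def by (rule Weierstrass_m_test[OF _ summable_exp_bound])
    then have "continuous_on (ball 0 r) (\<lambda>M. mexp_deriv M H)"
      by (rule uniform_limit_theorem[rotated])
        (auto intro!: always_eventually continuous_intros)
    then show ?thesis
      using r(2) by (simp add: continuous_on_eq_continuous_at)
  qed
  then show "continuous_on UNIV (\<lambda>M. mexp_deriv M H)"
    by (simp add: continuous_at_imp_continuous_on)
qed

lemma mpow_commutes: "mpow n M ** M = M ** mpow n M"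
  by (induction n) (simp_all add: matrix_mul_assoc[symmetric])

lemma mexp_commutes: "mexp (s *\<^sub>R M) ** M = M ** mexp (s *\<^sub>R M)"
proof -
  have comm: "mpow n (s *\<^sub>R M) ** M = M ** mpow n (s *\<^sub>R M)" for n
    by (induction n)
      (simp_all add: matrix_mul_assoc[symmetric] mm.scaleR_left mm.scaleR_right)
  have "(\<lambda>n. (1 / fact n) *\<^sub>R mpow n (s *\<^sub>R M) ** M) sums (mexp (s *\<^sub>R M) ** M)"
    using bounded_linear.sums[OF mm.bounded_linear_left mexp_sums] .
  moreover have "(\<lambda>n. M ** ((1 / fact n) *\<^sub>R mpow n (s *\<^sub>R M))) sums (M ** mexp (s *\<^sub>R M))"
    using bounded_linear.sums[OF mm.bounded_linear_right mexp_sums] .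
  ultimately show ?thesis
    by (simp add: sums_unique2 comm mm.scaleR_left mm.scaleR_right)
qed

lemma mpow_deriv_commuting:
  "mpow_deriv (Suc n) (s *\<^sub>R M) M = real (Suc n) *\<^sub>R (M ** mpow n (s *\<^sub>R M))"
proof (induction n)
  case 0
  then show ?case by (simp add: mm.zero_right)
next
  case (Suc n)
  have "mpow_deriv (Suc (Suc n)) (s *\<^sub>R M) M
    = M ** mpow (Suc n) (s *\<^sub>R M) + (s *\<^sub>R M) ** (real (Suc n) *\<^sub>R (M ** mpow n (s *\<^sub>R M)))"
    using Suc by (subst mpow_deriv.simps) (simp only:)
  also have "\<dots> = (s + s * real (Suc n)) *\<^sub>R (M ** (M ** mpow n (s *\<^sub>R M)))"
    by (simp only: funpow.simps o_apply mm.scaleR_left mm.scaleR_right scaleR_scaleR scaleR_add_left mult.commute[of s])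
  also have "\<dots> = real (Suc (Suc n)) *\<^sub>R (M ** mpow (Suc n) (s *\<^sub>R M))"
    by (simp add: mm.scaleR_left mm.scaleR_right algebra_simps)
  finally show ?case .
qed

text \<open>
  A direction commuting with the base point can be pulled out of every term, so the series
  for the derivative becomes a shifted exponential series.
\<close>
lemma mexp_deriv_commuting: "mexp_deriv (s *\<^sub>R M) M = M ** mexp (s *\<^sub>R M)"
proof -
  have "(\<lambda>n. M ** ((1 / fact n) *\<^sub>R mpow n (s *\<^sub>R M))) sums (M ** mexp (s *\<^sub>R M))"
    using bounded_linear.sums[OF mm.bounded_linear_right mexp_sums] .
  moreover have "M ** ((1 / fact n) *\<^sub>R mpow n (s *\<^sub>R M)) = (1 / fact (Suc n)) *\<^sub>R mpow_deriv (Suc n) (s *\<^sub>R M) M" for n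
    unfolding mpow_deriv_commuting by (simp add: mm.scaleR_right)
  ultimately have "(\<lambda>n. (1 / fact (Suc n)) *\<^sub>R mpow_deriv (Suc n) (s *\<^sub>R M) M) sums (M ** mexp (s *\<^sub>R M))"
    by simp
  then have "(\<lambda>n. (1 / fact n) *\<^sub>R mpow_deriv n (s *\<^sub>R M) M) sums (M ** mexp (s *\<^sub>R M))"
    by (subst (asm) sums_Suc_iff) simp
  then show ?thesis
    using sums_unique2 mexp_deriv_sums by blast
qed

lemma mexp_zero: "mexp 0 = mat 1"
proof -
  have "(\<lambda>n. (1 / fact n) *\<^sub>R mpow n 0) sums (\<Sum>n\<in>{0}. (1 / fact n) *\<^sub>R mpow n 0)"
  proof (rule sums_finite)
    fix n :: nat assume "n \<notin> {0}"
    then show "(1 / fact n) *\<^sub>R mpow n 0 = 0" by (cases n) (auto simp: mm.zero_left)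
  qed simp
  then show ?thesis using sums_unique2[OF mexp_sums] by force
qed

lemma mexp_line_has_derivative:
  "((\<lambda>s. mexp (s *\<^sub>R M)) has_vector_derivative M ** mexp (s *\<^sub>R M)) (at s)"
proof -
  have 1: "((\<lambda>s. s *\<^sub>R M) has_derivative (\<lambda>h. h *\<^sub>R M)) (at s)"
    by (auto intro!: derivative_eq_intros)
  have "((\<lambda>s. mexp (s *\<^sub>R M)) has_derivative (\<lambda>h. mexp_deriv (s *\<^sub>R M) (h *\<^sub>R M))) (at s)"
    using has_derivative_compose[OF 1 mexp_has_derivative] .
  moreover have "mexp_deriv (s *\<^sub>R M) (h *\<^sub>R M) = h *\<^sub>R (M ** mexp (s *\<^sub>R M))" for h
    using linear_scale[OF has_derivative_linear[OF mexp_has_derivative]]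
    by (simp add: mexp_deriv_commuting)
  ultimately show ?thesis
    by (simp add: has_vector_derivative_def)
qed

text \<open>
  The curve \<open>mexp (s M) ** mexp (- s M)\<close> has zero derivative, since \<open>M\<close> commutes with
  \<open>mexp (s M)\<close>, so it keeps its value at \<open>s = 0\<close>.
\<close>
lemma mexp_mult_mexp_uminus: "mexp M ** mexp (- M) = mat 1"
proof -
  let ?f = "\<lambda>s. mexp (s *\<^sub>R M) ** mexp (s *\<^sub>R (- M))"
  have "(?f has_vector_derivative 0) (at s within UNIV)" for s
  proof -
    have "(?f has_vector_derivative
        mexp (s *\<^sub>R M) ** (- M ** mexp (s *\<^sub>R (- M))) + (M ** mexp (s *\<^sub>R M)) ** mexp (s *\<^sub>R (- M))) (at s)"
      by (rule mm.has_vector_derivative[OF mexp_line_has_derivative mexp_line_has_derivative])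
    moreover have "mexp (s *\<^sub>R M) ** (- M ** mexp (s *\<^sub>R (- M))) = - ((mexp (s *\<^sub>R M) ** M) ** mexp (s *\<^sub>R (- M)))"
      by (simp only: mm.minus_left mm.minus_right matrix_mul_assoc)
    ultimately show ?thesis
      by (simp add: mexp_commutes)
  qed
  then obtain k where k: "\<And>s. s \<in> UNIV \<Longrightarrow> ?f s = k"
    using has_vector_derivative_zero_constant[OF convex_UNIV] by blast
  have "?f 1 = ?f 0" using k[of 0] k[of 1] by (simp del: scaleR_one)
  then show ?thesis by (simp add: mexp_zero)
qed

text \<open>
  This lets \<open>A\<^sup>-\<^sup>1\<close>, and hence \<open>G\<close>, inherit continuity, periodicity and symmetry from \<open>B\<close>.
\<close>
lemma matrix_inv_mexp: "matrix_inv (mexp M) = mexp (- M)"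
proof -
  have M: "mexp M ** mexp (- M) = mat 1" "mexp (- M) ** mexp M = mat 1"
    using mexp_mult_mexp_uminus[of M] mexp_mult_mexp_uminus[of "- M"] by auto
  have "mexp M ** matrix_inv (mexp M) = mat 1 \<and> matrix_inv (mexp M) ** mexp M = mat 1"
    unfolding matrix_inv_def by (rule someI) (use M in auto)
  then show ?thesis
    by (metis M(2) matrix_mul_assoc matrix_mul_lid matrix_mul_rid)
qed

lemma symmetric_mexp:
  assumes "symmetric M" shows "symmetric (mexp M)"
proof -
  have M: "transpose M = M" using assms by (simp add: symmetric_def)
  have "transpose (mpow n M) = mpow n M" for n
    by (induction n) (simp_all add: matrix_transpose_mul M mpow_commutes transpose_mat)
  then have "(\<lambda>n. (1 / fact n) *\<^sub>R mpow n M) sums transpose (mexp M)"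
    using bounded_linear.sums[OF bounded_linear_transpose mexp_sums[of M]] by (simp add: transpose_scalar)
  then show ?thesis
    unfolding symmetric_def using sums_unique2 mexp_sums by blast
qed

section \<open>Integrals of periodic fields\<close>

lemma frob_eq_inner: "M :\<^sub>F N = M \<bullet> N"
  by (simp add: frob_def trace_def matrix_matrix_mult_def transpose_def inner_vec_def)

abbreviation cell :: "real \<Rightarrow> (real^3) set" where
  "cell L \<equiv> cbox 0 (\<chi> i. L)"

lemma integrable_torus:
  fixes f :: "real^3 \<Rightarrow> 'b::euclidean_space"
  assumes "continuous_on UNIV f"
  shows "integrable (torus L) f"
  unfolding torus_def
  by (intro continuous_imp_integrable continuous_on_subset[OF assms]) auto

lemma LINT_torus:
  fixes f :: "real^3 \<Rightarrow> 'b::euclidean_space"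
  assumes "continuous_on UNIV f"
  shows "(LINT x|torus L. f x) = integral (cell L) f"
  using integrable_torus[OF assms, of L] unfolding torus_def
  by (intro lebesgue_integral_eq_integral) auto

lemma periodic_int_multiple:
  assumes "periodic L f"
  shows "f (x + (of_int k * L) *\<^sub>R axis i 1) = f x"
proof -
  have nat: "f (y + (real n * L) *\<^sub>R axis i 1) = f y" for n y
  proof (induction n)
    case (Suc n)
    have "y + (real (Suc n) * L) *\<^sub>R axis i 1 = (y + (real n * L) *\<^sub>R axis i 1) + L *\<^sub>R axis i 1"
      by (simp add: algebra_simps)
    then show ?case
      using assms Suc by (simp only: periodic_def)
  qed simp
  show ?thesis
  proof (cases "0 \<le> k")
    case True
    then show ?thesis using nat[of x "nat k"] by simp
  next
    case False
    then show ?thesis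
      using nat[of "x + (of_int k * L) *\<^sub>R axis i 1" "nat (- k)"] by (simp add: algebra_simps)
  qed
qed

text \<open>
  Every value of a periodic field is attained in the closed cell, so what is shown on the cell, where
  the integrals live, holds on the whole space.
\<close>
lemma periodic_value_in_cell:
  fixes f :: "real^3 \<Rightarrow> 'b"
  assumes "periodic L f" "0 < L"
  obtains y where "y \<in> cell L" "f y = f x"
proof -
  \<comment> \<open>Subtract whole periods in each coordinate separately.\<close>
  define k :: "3 \<Rightarrow> int" where "k i = - \<lfloor>x $ i / L\<rfloor>" for i
  define y where "y = x + (\<Sum>i\<in>UNIV. (of_int (k i) * L) *\<^sub>R axis i 1)"
  have "f (x + (\<Sum>i\<in>I. (of_int (k i) * L) *\<^sub>R axis i 1)) = f x" if "finite I" for I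
    using that
  proof (induction I)
    case (insert i I)
    then show ?case
      using periodic_int_multiple[OF assms(1), of "x + (\<Sum>i\<in>I. (of_int (k i) * L) *\<^sub>R axis i 1)" "k i" i]
      by (simp add: algebra_simps)
  qed simp
  then have "f y = f x" by (simp add: y_def)
  moreover have "0 \<le> y $ i \<and> y $ i \<le> L" for i
  proof -
    have "y $ i = x $ i - of_int \<lfloor>x $ i / L\<rfloor> * L"
      by (simp add: y_def k_def axis_def if_distrib cong: if_cong)
    then show ?thesis
      using floor_divide_lower[OF assms(2), of "x $ i"] floor_divide_upper[OF assms(2), of "x $ i"]
      by (simp add: algebra_simps)
  qed
  then have "y \<in> cell L" by (simp add: mem_box_cart)
  ultimately show thesis using that by blast
qed

text \<open>
  The union of the cell and its translate is cut once at \<open>x $ j = L\<close> and once at \<open>x $ j = s\<close>;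
  the two thin slabs that remain are translates of each other by one period.
\<close>
lemma cell_integral_shift:
  fixes g :: "real^3 \<Rightarrow> 'b::euclidean_space"
  assumes g: "continuous_on UNIV g" "periodic L g" and s: "0 \<le> s" "s \<le> L"
  shows "integral (cell L) (\<lambda>x. g (x + s *\<^sub>R axis j 1)) = integral (cell L) g"
proof -
  let ?e = "axis j 1 :: real^3" and ?L = "(\<chi> i. L) :: real^3"
  let ?big = "cbox 0 (?L + s *\<^sub>R ?e)"
  have int: "g integrable_on cbox a b" for a b
    by (intro integrable_continuous continuous_on_subset[OF g(1)]) auto
  have e: "?e \<in> Basis" by (auto simp: Basis_vec_def)
  have e_dot: "x \<bullet> ?e = x $ j" for x
    by (simp add: inner_axis)
  have e_comp: "?e $ i = (if i = j then 1 else 0)" for i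
    by (simp add: axis_def)
  have split: "integral ?big g = integral (?big \<inter> {x. x \<bullet> ?e \<le> c}) g + integral (?big \<inter> {x. x \<bullet> ?e \<ge> c}) g" for c
    by (rule integral_split[OF int e])
  \<comment> \<open>Cutting at \<open>L\<close> leaves the cell and a far slab, cutting at \<open>s\<close> a near slab and the translated cell.\<close>
  have low: "?big \<inter> {x. x \<bullet> ?e \<le> L} = cell L"
    using s by (auto simp: mem_box_cart e_dot e_comp split: if_splits; smt (verit))
  have high: "?big \<inter> {x. x \<bullet> ?e \<ge> L} = cbox (L *\<^sub>R ?e) (?L + s *\<^sub>R ?e)"
    using s by (auto simp: mem_box_cart e_dot e_comp split: if_splits; smt (verit))
  have low': "?big \<inter> {x. x \<bullet> ?e \<le> s} = cbox 0 (?L + s *\<^sub>R ?e - L *\<^sub>R ?e)"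
    using s by (auto simp: mem_box_cart e_dot e_comp split: if_splits; smt (verit))
  have high': "?big \<inter> {x. x \<bullet> ?e \<ge> s} = cbox (s *\<^sub>R ?e) (?L + s *\<^sub>R ?e)"
    using s by (auto simp: mem_box_cart e_dot e_comp split: if_splits; smt (verit))
  have "integral (cbox (L *\<^sub>R ?e) (?L + s *\<^sub>R ?e)) g
      = integral (cbox (L *\<^sub>R ?e - L *\<^sub>R ?e) (?L + s *\<^sub>R ?e - L *\<^sub>R ?e)) (\<lambda>x. g (x + L *\<^sub>R ?e))"
    by (rule integral_shift_cbox[symmetric])
  also have "\<dots> = integral (cbox 0 (?L + s *\<^sub>R ?e - L *\<^sub>R ?e)) g"
    using g(2) by (simp add: periodic_def)
  finally have strip: "integral (cbox (L *\<^sub>R ?e) (?L + s *\<^sub>R ?e)) g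
      = integral (cbox 0 (?L + s *\<^sub>R ?e - L *\<^sub>R ?e)) g" .
  have "integral (cell L) (\<lambda>x. g (x + s *\<^sub>R ?e)) = integral (cbox (s *\<^sub>R ?e) (?L + s *\<^sub>R ?e)) g"
    using integral_shift_cbox[of "s *\<^sub>R ?e" "s *\<^sub>R ?e" "?L + s *\<^sub>R ?e" g] by simp
  then show ?thesis
    using split[of L, unfolded low high] split[of s, unfolded low' high'] strip by simp
qed

text \<open>
  The integral of \<open>f (x + s e)\<close> over the cell does not depend on \<open>s\<close>; differentiating it under the
  integral sign at \<open>s = 0\<close> gives the integral of the derivative.
\<close>
lemma integral_directional_derivative_eq_0:
  fixes f :: "real^3 \<Rightarrow> 'b::euclidean_space"
  assumes f: "C1_within UNIV f D" "periodic L f" and "0 < L"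
  shows "integral (cell L) (\<lambda>x. D x (axis j 1)) = 0"
proof -
  let ?e = "axis j 1 :: real^3"
  let ?F = "\<lambda>s. integral (cell L) (\<lambda>x. f (x + s *\<^sub>R ?e))"
  have "(?F has_vector_derivative integral (cell L) (\<lambda>x. D (x + 0 *\<^sub>R ?e) ?e)) (at 0 within {0..L})"
  proof (rule leibniz_rule_vector_derivative)
    fix s x assume "s \<in> {0..L}"
    have 1: "((\<lambda>s. x + s *\<^sub>R ?e) has_derivative (\<lambda>h. h *\<^sub>R ?e)) (at s within {0..L})"
      by (auto intro!: derivative_eq_intros)
    have fd: "(f has_derivative D z) (at z)" for z
      using C1_withinD(1)[OF f(1)] by simp
    have "((\<lambda>s. f (x + s *\<^sub>R ?e)) has_derivative (\<lambda>h. D (x + s *\<^sub>R ?e) (h *\<^sub>R ?e))) (at s within {0..L})"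
      using has_derivative_compose[OF 1 fd] .
    then show "((\<lambda>s. f (x + s *\<^sub>R ?e)) has_vector_derivative D (x + s *\<^sub>R ?e) ?e) (at s within {0..L})"
      using linear_scale[OF has_derivative_linear[OF fd]] by (simp add: has_vector_derivative_def)
  next
    fix s :: real
    show "(\<lambda>x. f (x + s *\<^sub>R ?e)) integrable_on cell L"
      by (intro integrable_continuous continuous_on_compose2[OF C1_withinD(3)[OF f(1)]] continuous_intros) auto
  next
    show "continuous_on ({0..L} \<times> cell L) (\<lambda>(s, x). D (x + s *\<^sub>R ?e) ?e)"
      unfolding case_prod_beta
      by (intro continuous_on_compose2[OF C1_withinD(2)[OF f(1)]] continuous_intros) auto
  qed (use \<open>0 < L\<close> in auto)
  moreover have "(?F has_vector_derivative 0) (at 0 within {0..L})"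
  proof (rule has_vector_derivative_transform[OF _ _ has_vector_derivative_const])
    fix s assume "s \<in> {0..L}"
    then show "?F s = integral (cell L) f"
      by (intro cell_integral_shift C1_withinD(3)[OF f(1)] f(2)) auto
  qed (use \<open>0 < L\<close> in auto)
  ultimately show ?thesis
    using vector_derivative_unique_within_closed_interval[of 0 L 0] \<open>0 < L\<close> by fastforce
qed

text \<open>
  Turns \<open>G \<noteq> 0\<close> at some point of the whole space into a positive norm on the torus, and
  a property holding almost everywhere on the torus into one holding everywhere.
\<close>
lemma integral_square_eq_0_imp_eq_0:
  fixes M :: "real^3 \<Rightarrow> real^3^3"
  assumes M: "continuous_on UNIV M" "periodic L M" and "0 < L"
    and int: "(LINT x|torus L. M x \<bullet> M x) = 0"
  shows "M x = 0"
proof -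
  have cont: "continuous_on UNIV (\<lambda>x. M x \<bullet> M x)"
    by (intro continuous_intros M)
  have "integral (cell L) (\<lambda>x. M x \<bullet> M x) = 0"
    using int LINT_torus[OF cont] by simp
  moreover have "box 0 ((\<chi> i. L) :: real^3) \<noteq> {}"
    using \<open>0 < L\<close> by (auto simp: box_ne_empty inner_vec_def Basis_vec_def axis_def if_distrib cong: if_cong)
  ultimately have "\<forall>y\<in>cell L. M y \<bullet> M y = 0"
    using integral_cbox_eq_0_iff[OF continuous_on_subset[OF cont]] by force
  then show ?thesis
    using periodic_value_in_cell[OF M(2) \<open>0 < L\<close>, of x] by (metis inner_eq_zero_iff)
qed

section \<open>Slices of space-time fields\<close>

lemma continuous_on_time_slice: "continuous_on X (\<lambda>x. (t, x))"
  by (intro continuous_on_Pair continuous_on_const continuous_on_id)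

lemma C1_within_space_slice:
  fixes f :: "real \<Rightarrow> 'a::real_normed_vector \<Rightarrow> 'b::real_normed_vector"
  assumes "C1_within (J \<times> UNIV) (\<lambda>(t, x). f t x) D" and t: "t \<in> J"
  shows "C1_within UNIV (f t) (\<lambda>x v. D (t, x) (0, v))"
  unfolding C1_within_def
proof (intro conjI ballI allI)
  fix x :: 'a
  have 1: "((\<lambda>x. (t, x)) has_derivative (\<lambda>v. (0, v))) (at x)"
    by (rule has_derivative_Pair[OF has_derivative_const has_derivative_ident])
  have 2: "((\<lambda>(t, x). f t x) has_derivative D (t, x)) (at (t, x) within range (Pair t))"
    using t by (intro has_derivative_subset[OF C1_withinD(1)[OF assms(1)]]) auto
  show "(f t has_derivative (\<lambda>v. D (t, x) (0, v))) (at x)"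
    using has_derivative_in_compose[OF 1 2] by simp
next
  fix v
  show "continuous_on UNIV (\<lambda>x. D (t, x) (0, v))"
    by (rule continuous_on_compose2[OF C1_withinD(2)[OF assms(1)] continuous_on_time_slice])
      (use t in auto)
qed

lemma C1_within_time_slice:
  assumes "C1_within (J \<times> UNIV) (\<lambda>(t, x). f t x) D" and t: "t \<in> J"
  shows "((\<lambda>s. f s x) has_vector_derivative D (t, x) (1, 0)) (at t within J)"
proof -
  have 1: "((\<lambda>s. (s, x)) has_derivative (\<lambda>h. (h, 0))) (at t within J)"
    by (rule has_derivative_Pair[OF has_derivative_ident has_derivative_const])
  have D: "((\<lambda>(t, x). f t x) has_derivative D (t, x)) (at (t, x) within J \<times> UNIV)"
    using t by (intro C1_withinD(1)[OF assms(1)]) auto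
  have 2: "((\<lambda>(t, x). f t x) has_derivative D (t, x)) (at (t, x) within ((\<lambda>s. (s, x)) ` J))"
    by (intro has_derivative_subset[OF D]) auto
  have 3: "((\<lambda>s. f s x) has_derivative (\<lambda>h. D (t, x) (h, 0))) (at t within J)"
    using has_derivative_in_compose[OF 1 2] by simp
  have 4: "D (t, x) (h, 0) = h *\<^sub>R D (t, x) (1, 0)" for h
    using linear_scale[OF has_derivative_linear[OF D], of h "(1, 0)"] by simp
  show ?thesis
    unfolding has_vector_derivative_def by (rule has_derivative_eq_rhs[OF 3 ext[OF 4]])
qed

text \<open>
  Time derivatives are one-sided at the end points of \<open>J\<close>; they are still unique because no point
  of \<open>J\<close> is isolated.
\<close>
lemma at_within_interval_neq_bot:
  fixes J :: "real set"
  assumes "is_interval J" "interior J \<noteq> {}" "t \<in> J"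
  shows "at t within J \<noteq> bot"
proof -
  have "J \<noteq> {x}" for x using assms(2) by auto
  then have "t islimpt J"
    using assms(1,3) by (intro connected_imp_perfect) (auto simp: is_interval_connected)
  then show ?thesis by (simp add: trivial_limit_within)
qed

lemma time_deriv_eq:
  assumes "C1_within (J \<times> UNIV) (\<lambda>(t, x). f t x) D"
    and "is_interval J" "interior J \<noteq> {}" "t \<in> J"
  shows "time_deriv J f t x = D (t, x) (1, 0)"
  unfolding time_deriv_def
  by (rule vector_derivative_within[OF at_within_interval_neq_bot[OF assms(2-4)]
        C1_within_time_slice[OF assms(1,4)]])

lemma partial_eq:
  assumes "C1_within UNIV f D"
  shows "partial i f x = D x (axis i 1)"
  unfolding partial_def frechet_derivative_at[OF C1_withinD(1)[OF assms UNIV_I], symmetric] ..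

lemma continuous_on_partial:
  assumes "C1_within UNIV f D"
  shows "continuous_on UNIV (partial i f)"
proof -
  have "partial i f = (\<lambda>x. D x (axis i 1))"
    by (rule ext) (rule partial_eq[OF assms])
  then show ?thesis
    using C1_withinD(2)[OF assms] by simp
qed

text \<open>
  Iterating derivatives, as in the Laplacian, must not leave the class of periodic fields.
\<close>
lemma periodic_partial:
  assumes "C1_within UNIV f D" "periodic L f"
  shows "periodic L (partial i f)"
  unfolding periodic_def
proof (intro allI)
  fix x j
  let ?c = "L *\<^sub>R axis j 1 :: real^3"
  have 1: "((\<lambda>y. y + ?c) has_derivative (\<lambda>h. h)) (at x)"
    by (auto intro!: derivative_eq_intros)
  have "((\<lambda>y. f (y + ?c)) has_derivative D (x + ?c)) (at x)"
    using has_derivative_compose[OF 1, of f "D (x + ?c)"] C1_withinD(1)[OF assms(1), of "x + ?c"] by simp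
  then have "(f has_derivative D (x + ?c)) (at x)"
    using assms(2) by (simp add: periodic_def)
  then have "D (x + ?c) = D x"
    by (rule has_derivative_unique[OF _ C1_withinD(1)[OF assms(1), of x, simplified]])
  then show "partial i f (x + ?c) = partial i f x"
    by (simp add: partial_eq[OF assms(1)])
qed

section \<open>Zero mean of the momentum residual\<close>

lemma LINT_partial_eq_0:
  fixes f :: "real^3 \<Rightarrow> 'b::euclidean_space"
  assumes "C1_within UNIV f D" "periodic L f" "0 < L"
  shows "(LINT x|torus L. partial i f x) = 0"
proof -
  have "integral (cell L) (partial i f) = 0"
    unfolding partial_eq[OF assms(1), abs_def] by (rule integral_directional_derivative_eq_0[OF assms])
  then show ?thesis
    unfolding LINT_torus[OF continuous_on_partial[OF assms(1)]] .
qed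

lemma mat_divergence_mean_free:
  assumes M: "C1_within UNIV M D" "periodic L M" and "0 < L"
  shows "continuous_on UNIV (mat_divergence M)" "(LINT x|torus L. mat_divergence M x) = 0"
proof -
  define col :: "3 \<Rightarrow> real^3^3 \<Rightarrow> real^3" where "col j P = (\<chi> i. P $ i $ j)" for j P
  have col: "bounded_linear (col j)" for j
    by (rule linear_conv_bounded_linear[THEN iffD1]) (auto simp: linear_iff col_def vec_eq_iff)
  have eq: "mat_divergence M = (\<lambda>x. \<Sum>j\<in>UNIV. col j (partial j M x))"
    by (auto simp: mat_divergence_def col_def vec_eq_iff)
  show "continuous_on UNIV (mat_divergence M)"
    unfolding eq by (intro continuous_intros bounded_linear.continuous_on[OF col] continuous_on_partial[OF M(1)])
  have int: "integrable (torus L) (partial j M)" for j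
    by (intro integrable_torus continuous_on_partial[OF M(1)])
  show "(LINT x|torus L. mat_divergence M x) = 0"
    unfolding eq
    by (simp add: integral_bounded_linear[OF col int] LINT_partial_eq_0[OF assms]
        integrable_bounded_linear[OF col int] linear_0[OF bounded_linear.linear[OF col]])
qed

lemma laplacian_mean_free:
  assumes v: "C1_within UNIV v D" "periodic L v" and "0 < L"
    and v2: "\<And>i. C1_within UNIV (partial i v) (D2 i)"
  shows "continuous_on UNIV (laplacian v)" "(LINT x|torus L. laplacian v x) = 0"
proof -
  have eq: "laplacian v = (\<lambda>x. \<Sum>i\<in>UNIV. partial i (partial i v) x)"
    by (auto simp: laplacian_def)
  show "continuous_on UNIV (laplacian v)"
    unfolding eq by (intro continuous_intros continuous_on_partial[OF v2])
  show "(LINT x|torus L. laplacian v x) = 0"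
    unfolding eq
    by (simp add: integrable_torus continuous_on_partial[OF v2]
        LINT_partial_eq_0[OF v2 periodic_partial[OF v] \<open>0 < L\<close>])
qed

text \<open>
  The integral of the time derivative is the time derivative of the integral, which is constant.
\<close>
lemma time_deriv_mean_free:
  fixes u :: "real \<Rightarrow> real^3 \<Rightarrow> real^3"
  assumes u: "C1_within (J \<times> UNIV) (\<lambda>(t, x). u t x) D"
    and J: "is_interval J" "interior J \<noteq> {}" and t: "t \<in> J"
    and mean: "\<And>s. s \<in> J \<Longrightarrow> torus_mean L (u s) = c" and "0 < L"
  shows "continuous_on UNIV (time_deriv J u t)" "(LINT x|torus L. time_deriv J u t x) = 0"
proof -
  have eq: "time_deriv J u s x = D (s, x) (1, 0)" if "s \<in> J" for s x
    using time_deriv_eq[OF u J that] .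
  have contD: "continuous_on (J \<times> UNIV) (\<lambda>z. D z (1, 0))"
    by (rule C1_withinD(2)[OF u])
  show cont: "continuous_on UNIV (time_deriv J u t)"
    unfolding eq[OF t, abs_def]
    by (rule continuous_on_compose2[OF contD continuous_on_time_slice]) (use t in auto)
  have contu: "continuous_on UNIV (u s)" if "s \<in> J" for s
    using C1_withinD(3)[OF C1_within_space_slice[OF u that]] .
  let ?F = "\<lambda>s. integral (cell L) (u s)"
  have "(?F has_vector_derivative integral (cell L) (\<lambda>x. D (t, x) (1, 0))) (at t within J)"
  proof (rule leibniz_rule_vector_derivative)
    show "u s integrable_on cell L" if "s \<in> J" for s
      by (intro integrable_continuous continuous_on_subset[OF contu[OF that]]) auto
    show "continuous_on (J \<times> cell L) (\<lambda>(s, x). D (s, x) (1, 0))"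
      unfolding case_prod_beta prod.collapse by (rule continuous_on_subset[OF contD]) auto
    show "convex J" using J(1) by (simp add: is_interval_convex)
  qed (use t in \<open>auto intro: C1_within_time_slice[OF u]\<close>)
  moreover have "(?F has_vector_derivative 0) (at t within J)"
  proof (rule has_vector_derivative_transform[OF t _ has_vector_derivative_const])
    fix s assume s: "s \<in> J"
    have "(1 / L ^ 3) *\<^sub>R ?F s = c"
      using mean[OF s] by (simp add: torus_mean_def LINT_torus[OF contu[OF s]])
    then have "L ^ 3 *\<^sub>R ((1 / L ^ 3) *\<^sub>R ?F s) = L ^ 3 *\<^sub>R c"
      by simp
    then show "?F s = L ^ 3 *\<^sub>R c" using \<open>0 < L\<close> by simp
  qed
  ultimately have "integral (cell L) (\<lambda>x. D (t, x) (1, 0)) = 0"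
    using vector_derivative_unique_within[OF at_within_interval_neq_bot[OF J t]] by blast
  then have "integral (cell L) (time_deriv J u t) = 0"
    unfolding eq[OF t, abs_def] .
  then show "(LINT x|torus L. time_deriv J u t x) = 0"
    unfolding LINT_torus[OF cont] .
qed

lemma bounded_bilinear_outer: "bounded_bilinear outer"
  by (rule bilinear_conv_bounded_bilinear[THEN iffD1])
    (auto simp: bilinear_def linear_iff outer_def vec_eq_iff algebra_simps)

text \<open>
  Apart from the time derivative, every term of the residual is a sum of first partial derivatives of
  periodic fields.
\<close>
lemma momentum_residual_mean_free:
  assumes "0 < L" and J: "is_interval J" "interior J \<noteq> {}" and t: "t \<in> J"
    and u: "smooth_on (J \<times> UNIV) (\<lambda>(t, x). u t x)" "periodic L (u t)"
    and B: "C1_within (J \<times> UNIV) (\<lambda>(t, x). B t x) DB" "periodic L (B t)"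
    and mean: "\<And>s. s \<in> J \<Longrightarrow> torus_mean L (u s) = c"
  shows "torus_mean L (momentum_residual J \<nu> \<alpha> u B t) = 0"
proof -
  let ?D = "\<lambda>z. frechet_derivative (\<lambda>(t, x). u t x) (at z within J \<times> UNIV)"
  have u1: "C1_within (J \<times> UNIV) (\<lambda>(t, x). u t x) ?D"
    by (rule smooth_on_C1_within[OF u(1)])
  note ut = C1_within_space_slice[OF u1 t]
  have "\<exists>D2. C1_within UNIV (partial i (u t)) D2" for i
  proof -
    have "(\<lambda>(t, x). ?D (t, x) (0, axis i 1)) = (\<lambda>z. ?D z (0, axis i 1))"
      by (rule ext) (simp split: prod.split)
    then obtain D2 where "C1_within (J \<times> UNIV) (\<lambda>(t, x). ?D (t, x) (0, axis i 1)) D2"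
      using smooth_on_derivative_C1_within[OF u(1), of "(0, axis i 1)"] by metis
    from C1_within_space_slice[OF this t] show ?thesis
      unfolding partial_eq[OF ut, abs_def] by blast
  qed
  then obtain D2 where D2: "\<And>i. C1_within UNIV (partial i (u t)) (D2 i)"
    by metis
  have Bt: "C1_within UNIV (\<lambda>y. mexp (B t y) - mat 1) (\<lambda>y v. mexp_deriv (B t y) (DB (t, y) (0, v)))"
    by (intro C1_within_diff_const C1_within_compose[OF C1_within_space_slice[OF B(1) t] mexp_C1])
  have per: "periodic L (\<lambda>y. outer (u t y) (u t y))" "periodic L (\<lambda>y. mexp (B t y) - mat 1)"
    using u(2) B(2) by (auto simp: periodic_def)
  note time = time_deriv_mean_free[OF u1 J t mean \<open>0 < L\<close>]
    and conv = mat_divergence_mean_free[OF C1_within_bilinear[OF bounded_bilinear_outer ut ut] per(1) \<open>0 < L\<close>]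
    and lap = laplacian_mean_free[OF ut u(2) \<open>0 < L\<close> D2]
    and stress = mat_divergence_mean_free[OF Bt per(2) \<open>0 < L\<close>]
  show ?thesis
    unfolding torus_mean_def momentum_residual_def
    by (simp add: integrable_torus time conv lap stress)
qed

section \<open>Symmetry and continuity of the stress residual\<close>

text \<open>
  Transposition is linear, so the transposed derivative is again a derivative of the
  same curve; uniqueness makes the two agree.
\<close>
lemma symmetric_vector_derivative:
  assumes f: "(f has_vector_derivative d) (at t within J)" and "at t within J \<noteq> bot" "t \<in> J"
    and sym: "\<And>s. s \<in> J \<Longrightarrow> symmetric (f s)"
  shows "symmetric d"
proof -
  have "((\<lambda>s. transpose (f s)) has_vector_derivative transpose d) (at t within J)"
    using bounded_linear.has_vector_derivative[OF bounded_linear_transpose f] .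
  then have "(f has_vector_derivative transpose d) (at t within J)"
    by (rule has_vector_derivative_transform[OF assms(3), rotated])
      (use sym in \<open>auto simp: symmetric_def\<close>)
  then show ?thesis
    unfolding symmetric_def using vector_derivative_unique_within[OF assms(2) _ f] by blast
qed

lemma symmetric_partial:
  assumes f: "C1_within UNIV f D" and sym: "\<And>x. symmetric (f x)"
  shows "symmetric (partial i f x)"
proof -
  have "((\<lambda>y. transpose (f y)) has_derivative (\<lambda>h. transpose (D x h))) (at x)"
    using bounded_linear.has_derivative[OF bounded_linear_transpose C1_withinD(1)[OF f]] by simp
  then have "(f has_derivative (\<lambda>h. transpose (D x h))) (at x)"
    using sym by (simp add: symmetric_def)
  then have "(\<lambda>h. transpose (D x h)) = D x"
    by (rule has_derivative_unique[OF _ C1_withinD(1)[OF f, of x, simplified]])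
  then show ?thesis
    unfolding symmetric_def partial_eq[OF f] by metis
qed

text \<open>
  The stretching term \<open>\<nabla>u A + A (\<nabla>u)\<^sup>T\<close> is symmetric only as a whole, each summand being the
  transpose of the other.
\<close>
lemma stress_residual_symmetric_continuous:
  assumes J: "is_interval J" "interior J \<noteq> {}" and t: "t \<in> J"
    and u: "C1_within (J \<times> UNIV) (\<lambda>(t, x). u t x) Du"
    and B: "C1_within (J \<times> UNIV) (\<lambda>(t, x). B t x) DB"
    and sym: "\<And>s x. s \<in> J \<Longrightarrow> symmetric (B s x)"
  shows "symmetric (stress_residual J lam u B t x)"
    and "continuous_on UNIV (stress_residual J lam u B t)"
proof -
  define A where "A = (\<lambda>s y. mexp (B s y))"
  have A: "C1_within (J \<times> UNIV) (\<lambda>(s, y). A s y) (\<lambda>z v. mexp_deriv (B (fst z) (snd z)) (DB z v))"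
    using C1_within_compose[OF B mexp_C1] by (simp add: A_def case_prod_unfold)
  note At = C1_within_space_slice[OF A t] and ut = C1_within_space_slice[OF u t]
  have symA: "symmetric (A s y)" if "s \<in> J" for s y
    using that by (simp add: A_def symmetric_mexp sym)
  have eq: "stress_residual J lam u B t = (\<lambda>x. time_deriv J A t x + advect (u t) (A t) x
     - nabla (u t) x ** A t x - A t x ** transpose (nabla (u t) x)
     + inverse lam *\<^sub>R (A t x - mat 1))"
    by (simp add: stress_residual_def A_def fun_eq_iff)
  have 1: "symmetric (time_deriv J A t x)"
    unfolding time_deriv_eq[OF A J t]
    by (rule symmetric_vector_derivative[OF C1_within_time_slice[OF A t] at_within_interval_neq_bot[OF J t] t symA])
  have 2: "symmetric (advect (u t) (A t) x)"
    unfolding advect_def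
    by (intro symmetric_sum symmetric_scaleR symmetric_partial[OF At] symA t)
  have 3: "symmetric (nabla (u t) x ** A t x + A t x ** transpose (nabla (u t) x))"
    using symA[OF t, of x]
    by (simp add: symmetric_def linear_add[OF bounded_linear.linear[OF bounded_linear_transpose]]
        matrix_transpose_mul add.commute)
  have "symmetric (time_deriv J A t x + advect (u t) (A t) x
     - (nabla (u t) x ** A t x + A t x ** transpose (nabla (u t) x))
     + inverse lam *\<^sub>R (A t x - mat 1))"
    by (intro symmetric_add symmetric_diff symmetric_scaleR symmetric_mat 1 2 3 symA t)
  then show "symmetric (stress_residual J lam u B t x)"
    unfolding eq by (simp add: diff_diff_eq)
  have c1: "continuous_on UNIV (time_deriv J A t)"
    unfolding time_deriv_eq[OF A J t, abs_def]
    by (rule continuous_on_compose2[OF C1_withinD(2)[OF A] continuous_on_time_slice]) (use t in auto)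
  have c2: "continuous_on UNIV (advect (u t) (A t))"
    unfolding advect_def[abs_def]
    by (intro continuous_intros continuous_on_partial[OF At] C1_withinD(3)[OF ut])
  have c3: "continuous_on UNIV (nabla (u t))"
    unfolding nabla_def[abs_def]
    by (intro continuous_on_vec_lambda continuous_intros continuous_on_partial[OF ut])
  show "continuous_on UNIV (stress_residual J lam u B t)"
    unfolding eq
    by (intro continuous_intros mm.continuous_on c1 c2 c3 C1_withinD(3)[OF At]
        bounded_linear.continuous_on[OF bounded_linear_transpose])
qed

section \<open>Defects of least norm\<close>

lemma continuous_in_L2_sym:
  assumes "continuous_on UNIV M" "\<And>x. symmetric (M x)"
  shows "M \<in> L2_sym L"
  using assms integrable_torus[of "\<lambda>x. M x \<bullet> M x" L] borel_measurable_integrable[OF integrable_torus[OF assms(1), of L]]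
  by (auto simp: L2_sym_def frob_eq_inner intro!: continuous_intros)

lemma L2_norm_square: "(L2_norm L M)\<^sup>2 = (LINT x|torus L. M x \<bullet> M x)"
  by (simp add: L2_norm_def frob_eq_inner)

lemma L2_norm_nonneg: "0 \<le> L2_norm L M"
  by (simp add: L2_norm_def frob_eq_inner)

lemma L2_norm_scaleR: "L2_norm L (\<lambda>x. c *\<^sub>R M x) = \<bar>c\<bar> * L2_norm L M"
  by (simp add: L2_norm_def frob_eq_inner real_sqrt_mult flip: mult.assoc)

lemma L2_sym_scaleR:
  assumes "M \<in> L2_sym L" shows "(\<lambda>x. c *\<^sub>R M x) \<in> L2_sym L"
  using assms by (auto simp: L2_sym_def frob_eq_inner symmetric_scaleR)

text \<open>
  From \<open>\<bar>a \<bullet> b\<bar> \<le> a \<bullet> a + b \<bullet> b\<close>, which is the positivity of the squares of \<open>a + b\<close> and \<open>a - b\<close>.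
\<close>
lemma L2_sym_integrable_inner:
  assumes "M \<in> L2_sym L" "N \<in> L2_sym L"
  shows "integrable (torus L) (\<lambda>x. M x \<bullet> N x)"
proof (rule Bochner_Integration.integrable_bound)
  show "integrable (torus L) (\<lambda>x. M x \<bullet> M x + N x \<bullet> N x)"
    using assms by (simp add: L2_sym_def frob_eq_inner)
  show "(\<lambda>x. M x \<bullet> N x) \<in> borel_measurable (torus L)"
    using assms by (auto simp: L2_sym_def)
  have "\<bar>a \<bullet> b\<bar> \<le> a \<bullet> a + b \<bullet> b" for a b :: "real^3^3"
  proof -
    have "0 \<le> (a + b) \<bullet> (a + b)" "0 \<le> (a - b) \<bullet> (a - b)" "0 \<le> a \<bullet> a" "0 \<le> b \<bullet> b"
      by simp_all
    then show ?thesis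
      by (simp add: inner_add_left inner_add_right inner_diff_left inner_diff_right inner_commute)
  qed
  then show "AE x in torus L. norm (M x \<bullet> N x) \<le> norm (M x \<bullet> M x + N x \<bullet> N x)"
    by (simp add: add_nonneg_nonneg)
qed

text \<open>
  The candidates form a half-space of \<open>L\<^sup>2\<close> with normal \<open>G\<close>, and \<open>- c G\<close> is the point of it nearest
  to the origin. The angle at that point between the origin and any candidate is at least a right angle,
  whence an inequality of Pythagoras. Both the lower bound for the norm of candidates
  and the uniqueness of the minimiser are read off from it.
\<close>
lemma candidate_defect_pythagoras:
  assumes G: "G \<in> L2_sym L" "0 < L2_norm L G" and "0 < \<alpha>" "0 \<le> P"
    and T: "T \<in> candidate_defects L \<alpha> P G"
    and c: "c = 2 * P / (\<alpha> * (L2_norm L G)\<^sup>2)"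
  shows "integrable (torus L) (\<lambda>x. (T x + c *\<^sub>R G x) \<bullet> (T x + c *\<^sub>R G x))"
    and "(LINT x|torus L. (T x + c *\<^sub>R G x) \<bullet> (T x + c *\<^sub>R G x)) + (c * L2_norm L G)\<^sup>2 \<le> (L2_norm L T)\<^sup>2"
proof -
  have T2: "T \<in> L2_sym L" and work: "P + \<alpha> / 2 * (LINT x|torus L. G x \<bullet> T x) \<le> 0"
    using T by (auto simp: candidate_defects_def frob_eq_inner)
  note int = L2_sym_integrable_inner[OF T2 T2] L2_sym_integrable_inner[OF G(1) T2]
    L2_sym_integrable_inner[OF G(1) G(1)]
  have eq: "(T x + c *\<^sub>R G x) \<bullet> (T x + c *\<^sub>R G x)
      = T x \<bullet> T x + (2 * c) * (G x \<bullet> T x) + c\<^sup>2 * (G x \<bullet> G x)" for x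
    by (simp add: inner_add_left inner_add_right inner_commute power2_eq_square algebra_simps)
  show "integrable (torus L) (\<lambda>x. (T x + c *\<^sub>R G x) \<bullet> (T x + c *\<^sub>R G x))"
    unfolding eq by (intro Bochner_Integration.integrable_add integrable_mult_right int)
  have "(LINT x|torus L. (T x + c *\<^sub>R G x) \<bullet> (T x + c *\<^sub>R G x))
      = (L2_norm L T)\<^sup>2 + (2 * c) * (LINT x|torus L. G x \<bullet> T x) + c\<^sup>2 * (L2_norm L G)\<^sup>2"
    unfolding eq L2_norm_square using int by simp
  moreover have "(2 * c) * (LINT x|torus L. G x \<bullet> T x) \<le> (2 * c) * (- (c * (L2_norm L G)\<^sup>2))"
  proof (rule mult_left_mono)
    have "c * (L2_norm L G)\<^sup>2 = 2 * P / \<alpha>"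
      using G(2) by (simp add: c)
    moreover have "(LINT x|torus L. G x \<bullet> T x) \<le> - (2 * P / \<alpha>)"
      using work \<open>0 < \<alpha>\<close> by (simp add: field_simps)
    ultimately show "(LINT x|torus L. G x \<bullet> T x) \<le> - (c * (L2_norm L G)\<^sup>2)"
      by simp
    show "0 \<le> 2 * c" using assms by (simp add: c)
  qed
  ultimately show "(LINT x|torus L. (T x + c *\<^sub>R G x) \<bullet> (T x + c *\<^sub>R G x)) + (c * L2_norm L G)\<^sup>2 \<le> (L2_norm L T)\<^sup>2"
    by (simp add: power2_eq_square algebra_simps)
qed

text \<open>
  For \<open>P > 0\<close> the left-hand side is \<open>c\<close> times the norm of \<open>G\<close>, with the \<open>c\<close> of
  \<open>candidate_defect_pythagoras\<close>: the distance of the half-space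
  from the origin. For \<open>P \<le> 0\<close> it vanishes.
\<close>
lemma candidate_defect_norm_ge:
  assumes G: "G \<in> L2_sym L" "0 < L2_norm L G" and "0 < \<alpha>"
    and T: "T \<in> candidate_defects L \<alpha> P G"
  shows "2 * max P 0 / (\<alpha> * L2_norm L G) \<le> L2_norm L T"
proof (cases "0 \<le> P")
  case True
  define c where "c = 2 * P / (\<alpha> * (L2_norm L G)\<^sup>2)"
  have "0 \<le> (LINT x|torus L. (T x + c *\<^sub>R G x) \<bullet> (T x + c *\<^sub>R G x))"
    by simp
  then have "(c * L2_norm L G)\<^sup>2 \<le> (L2_norm L T)\<^sup>2"
    using candidate_defect_pythagoras(2)[OF G \<open>0 < \<alpha>\<close> True T c_def] by linarith
  then have "c * L2_norm L G \<le> L2_norm L T"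
    using L2_norm_nonneg by (rule power2_le_imp_le)
  then show ?thesis
    using True G(2) by (simp add: c_def power2_eq_square)
next
  case False
  then show ?thesis by (simp add: L2_norm_nonneg max_def)
qed

text \<open>
  The constant \<open>c\<close> is the one that turns the work inequality into an equality.
\<close>
lemma scaled_candidate_defect:
  assumes G: "G \<in> L2_sym L" "0 < L2_norm L G" and "0 < \<alpha>" "0 \<le> P"
    and c: "c = 2 * P / (\<alpha> * (L2_norm L G)\<^sup>2)"
  shows "(\<lambda>x. - c *\<^sub>R G x) \<in> candidate_defects L \<alpha> P G"
    and "L2_norm L (\<lambda>x. - c *\<^sub>R G x) = 2 * P / (\<alpha> * L2_norm L G)"
proof -
  have "(LINT x|torus L. G x \<bullet> (- c *\<^sub>R G x)) = - (c * (L2_norm L G)\<^sup>2)"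
    by (simp add: L2_norm_square)
  also have "\<dots> = - (2 * P / \<alpha>)"
    using G(2) by (simp add: c)
  finally show "(\<lambda>x. - c *\<^sub>R G x) \<in> candidate_defects L \<alpha> P G"
    using L2_sym_scaleR[OF G(1), of "- c"] \<open>0 < \<alpha>\<close> by (simp add: candidate_defects_def frob_eq_inner)
  have "0 \<le> c" using assms by (simp add: c)
  then have "L2_norm L (\<lambda>x. - c *\<^sub>R G x) = c * L2_norm L G"
    unfolding L2_norm_scaleR by simp
  then show "L2_norm L (\<lambda>x. - c *\<^sub>R G x) = 2 * P / (\<alpha> * L2_norm L G)"
    using G(2) by (simp add: c power2_eq_square)
qed

lemma minimal_defect_unique:
  assumes G: "G \<in> L2_sym L" "0 < L2_norm L G" and "0 < \<alpha>" "0 \<le> P"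
    and c: "c = 2 * P / (\<alpha> * (L2_norm L G)\<^sup>2)"
    and T: "T \<in> candidate_defects L \<alpha> P G" "L2_norm L T \<le> 2 * P / (\<alpha> * L2_norm L G)"
  shows "AE x in torus L. T x = - c *\<^sub>R G x"
proof -
  note pyth = candidate_defect_pythagoras[OF G \<open>0 < \<alpha>\<close> \<open>0 \<le> P\<close> T(1) c]
  have "c * L2_norm L G = 2 * P / (\<alpha> * L2_norm L G)"
    using G(2) by (simp add: c power2_eq_square)
  then have "(L2_norm L T)\<^sup>2 \<le> (c * L2_norm L G)\<^sup>2"
    using T(2) L2_norm_nonneg by (simp add: power_mono)
  moreover have "0 \<le> (LINT x|torus L. (T x + c *\<^sub>R G x) \<bullet> (T x + c *\<^sub>R G x))"
    by simp
  ultimately have "(LINT x|torus L. (T x + c *\<^sub>R G x) \<bullet> (T x + c *\<^sub>R G x)) = 0"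
    using pyth(2) by linarith
  then have "AE x in torus L. (T x + c *\<^sub>R G x) \<bullet> (T x + c *\<^sub>R G x) = 0"
    using integral_nonneg_eq_0_iff_AE[OF pyth(1)] by simp
  then show ?thesis
    by eventually_elim (simp add: eq_neg_iff_add_eq_0)
qed

section \<open>Consequences of admissibility\<close>

text \<open>
  The pressure tensor does no work, because the trace of the symmetric gradient is the divergence.
\<close>
lemma frob_pressure_symgrad:
  assumes "divergence v x = 0"
  shows "(R + q *\<^sub>R mat 1) :\<^sub>F symgrad v x = R :\<^sub>F symgrad v x"
proof -
  have "mat 1 \<bullet> symgrad v x = divergence v x"
    by (simp add: inner_vec_def mat_def symgrad_def nabla_def divergence_def transpose_def if_distrib
        if_distribR cong: if_cong)
  then show ?thesis
    using assms by (simp add: frob_eq_inner inner_add_left)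
qed

text \<open>
  If the work density of \<open>R\<close> is integrable, the work integral splits into \<open>P\<close> and the work of \<open>T\<close>, and
  the admissibility inequality is literally the one defining the candidates. If it is not integrable, then \<open>P\<close> is
  \<open>0\<close>, the value of the Bochner integral of a non-integrable function. Either way the positive part of \<open>P\<close>
  is bounded by the work that \<open>T\<close> can do.
\<close>
lemma admissible_imp_candidate_defect:
  fixes R :: "real^3 \<Rightarrow> real^3^3"
  assumes work: "(LINT x|torus L. - (R x :\<^sub>F D x) + \<alpha> / 2 * (G x :\<^sub>F T x)) \<le> 0"
    and P: "P = (LINT x|torus L. - (R x :\<^sub>F D x))"
    and G: "G \<in> L2_sym L" and T: "T \<in> L2_sym L"
  shows "P = 0 \<or> T \<in> candidate_defects L \<alpha> P G"
proof (cases "integrable (torus L) (\<lambda>x. - (R x :\<^sub>F D x))")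
  case True
  have "integrable (torus L) (\<lambda>x. G x :\<^sub>F T x)"
    unfolding frob_eq_inner by (rule L2_sym_integrable_inner[OF G T])
  then show ?thesis
    using work T True by (simp add: P candidate_defects_def)
next
  case False
  then show ?thesis by (simp add: P not_integrable_integral_eq)
qed

text \<open>
  For a nonzero \<open>G\<close> this is the lower bound for candidates multiplied out; for \<open>G = 0\<close> no defect can
  do any work, and the candidate inequality itself says \<open>P \<le> 0\<close>.
\<close>
lemma positive_part_le_defect_work:
  assumes G: "G \<in> L2_sym L" "L2_norm L G = 0 \<Longrightarrow> \<forall>x. G x = 0" and "0 < \<alpha>"
    and T: "P = 0 \<or> T \<in> candidate_defects L \<alpha> P G"
  shows "max P 0 \<le> \<alpha> / 2 * L2_norm L G * L2_norm L T"
proof (cases "P = 0")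
  case True
  then show ?thesis using \<open>0 < \<alpha>\<close> by (simp add: L2_norm_nonneg)
next
  case False
  then have T: "T \<in> candidate_defects L \<alpha> P G" using T by simp
  show ?thesis
  proof (cases "L2_norm L G = 0")
    case True
    then have "P \<le> 0"
      using G(2) T by (simp add: candidate_defects_def frob_eq_inner)
    then show ?thesis using True by simp
  next
    case False
    then have "0 < L2_norm L G" using L2_norm_nonneg[of L G] by simp
    then show ?thesis
      using candidate_defect_norm_ge[OF G(1) _ \<open>0 < \<alpha>\<close> T] \<open>0 < \<alpha>\<close> by (simp add: field_simps)
  qed
qed

theorem theorem1p4:
  fixes L \<nu> \<alpha> lam :: real and J :: "real set"
    and u :: "real \<Rightarrow> real ^ 3 \<Rightarrow> real ^ 3"
    and p :: "real \<Rightarrow> real ^ 3 \<Rightarrow> real"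
    and A B S R\<^sub>N G :: "real \<Rightarrow> real ^ 3 \<Rightarrow> real ^ 3 ^ 3"
    and N :: "real \<Rightarrow> real ^ 3 \<Rightarrow> real ^ 3"
    and P :: "real \<Rightarrow> real"
  assumes "0 < L" "0 < \<nu>" "0 < \<alpha>" "0 < lam"
    and "is_interval J" "interior J \<noteq> {}"
    and "smooth_on (J \<times> UNIV) (\<lambda>(t, x). u t x)" "\<forall>t\<in>J. periodic L (u t)"
    and "smooth_on (J \<times> UNIV) (\<lambda>(t, x). p t x)" "\<forall>t\<in>J. periodic L (p t)"
    and "smooth_on (J \<times> UNIV) (\<lambda>(t, x). B t x)" "\<forall>t\<in>J. periodic L (B t)"
    and "\<forall>t\<in>J. \<forall>x. symmetric (B t x)"
    and "\<forall>t\<in>J. \<forall>x. divergence (u t) x = 0"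
    and "\<exists>c. \<forall>t\<in>J. torus_mean L (u t) = c"
    and A: "A = (\<lambda>t x. mexp (B t x))"
    and S: "S = stress_residual J lam u B"
    and N: "N = momentum_residual J \<nu> \<alpha> u B"
    and R\<^sub>N: "R\<^sub>N = (\<lambda>t. antidiv L (N t))"
    and P: "P = (\<lambda>t. LINT x|torus L. - (R\<^sub>N t x :\<^sub>F symgrad (u t) x))"
    and G: "G = (\<lambda>t x. mat 1 - matrix_inv (A t x))"
  shows
    "(\<forall>t\<in>J. \<forall>x. symmetric (S t x)) \<and>
     (\<forall>t\<in>J. torus_mean L (N t) = 0) \<and>
     \<comment> \<open>(i)\<close>
     (residual_matching_admissible L J \<nu> \<alpha> lam u p B \<longrightarrow>
        (AE t in lebesgue. t \<in> J \<longrightarrow>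
           max (P t) 0 \<le> \<alpha> / 2 * L2_norm L (G t) * L2_norm L (S t))) \<and>
     \<comment> \<open>(ii)\<close>
     (\<forall>t\<in>J. (\<exists>x. G t x \<noteq> 0) \<longrightarrow>
        (\<exists>T\<in>candidate_defects L \<alpha> (P t) (G t).
           L2_norm L T = 2 * max (P t) 0 / (\<alpha> * L2_norm L (G t))) \<and>
        (\<forall>T\<in>candidate_defects L \<alpha> (P t) (G t).
           2 * max (P t) 0 / (\<alpha> * L2_norm L (G t)) \<le> L2_norm L T) \<and>
        (P t > 0 \<longrightarrow>
           (let S_min = (\<lambda>x. - (2 * P t / (\<alpha> * (L2_norm L (G t))\<^sup>2)) *\<^sub>R G t x) in
              (\<forall>x. symmetric (S_min x)) \<and>
              is_arg_min (L2_norm L) (\<lambda>T. T \<in> candidate_defects L \<alpha> (P t) (G t)) S_min \<and>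
              (\<forall>T. is_arg_min (L2_norm L) (\<lambda>T. T \<in> candidate_defects L \<alpha> (P t) (G t)) T \<longrightarrow>
                 (AE x in torus L. T x = S_min x))))) \<and>
     (residual_matching_admissible L J \<nu> \<alpha> lam u p B \<longrightarrow>
        (AE t in lebesgue. t \<in> J \<longrightarrow> (\<exists>x. G t x \<noteq> 0) \<longrightarrow>
           2 * max (P t) 0 / (\<alpha> * L2_norm L (G t)) \<le> L2_norm L (S t))) \<and>
     \<comment> \<open>(iii)\<close>
     (\<forall>t\<in>J. (\<forall>x. G t x = 0) \<longleftrightarrow> (AE x in torus L. A t x = mat 1)) \<and>
     (residual_matching_admissible L J \<nu> \<alpha> lam u p B \<longrightarrow>
        (AE t in lebesgue. t \<in> J \<longrightarrow> (\<forall>x. G t x = 0) \<longrightarrow> P t \<le> 0))"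
proof -
  let ?X = "J \<times> (UNIV :: (real^3) set)"
  note L = \<open>0 < L\<close> and \<alpha> = \<open>0 < \<alpha>\<close> and J = \<open>is_interval J\<close> \<open>interior J \<noteq> {}\<close>
  note uper = \<open>\<forall>t\<in>J. periodic L (u t)\<close> and Bper = \<open>\<forall>t\<in>J. periodic L (B t)\<close>
    and Bsym = \<open>\<forall>t\<in>J. \<forall>x. symmetric (B t x)\<close> and div0 = \<open>\<forall>t\<in>J. \<forall>x. divergence (u t) x = 0\<close>
  note u1 = smooth_on_C1_within[OF \<open>smooth_on ?X (\<lambda>(t, x). u t x)\<close>]
    and B1 = smooth_on_C1_within[OF \<open>smooth_on ?X (\<lambda>(t, x). B t x)\<close>]
  have Ssym: "symmetric (S t x)" and Scont: "continuous_on UNIV (S t)" if "t \<in> J" for t x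
    using stress_residual_symmetric_continuous[OF J that u1 B1] Bsym by (auto simp: S)
  have Nmean: "torus_mean L (N t) = 0" if t: "t \<in> J" for t
  proof -
    obtain c where "\<And>s. s \<in> J \<Longrightarrow> torus_mean L (u s) = c"
      using \<open>\<exists>c. \<forall>t\<in>J. torus_mean L (u t) = c\<close> by blast
    then show ?thesis
      unfolding N
      using momentum_residual_mean_free[OF L J t \<open>smooth_on ?X (\<lambda>(t, x). u t x)\<close> _ B1] uper Bper t
      by blast
  qed
  have G_eq: "G t x = mat 1 - mexp (- B t x)" for t x
    by (simp add: G A matrix_inv_mexp)
  have Gsym: "symmetric (G t x)" if "t \<in> J" for t x
    using Bsym that symmetric_scaleR[of "B t x" "- 1"]
    by (simp add: G_eq symmetric_diff symmetric_mat symmetric_mexp)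
  have Gcont: "continuous_on UNIV (G t)" if t: "t \<in> J" for t
  proof -
    have "continuous_on UNIV (\<lambda>x. mexp (- B t x))"
      by (rule continuous_on_compose2[OF C1_withinD(3)[OF mexp_C1]
            continuous_on_minus[OF C1_withinD(3)[OF C1_within_space_slice[OF B1 t]]]]) simp
    then show ?thesis
      unfolding G_eq[abs_def] by (intro continuous_on_diff continuous_on_const)
  qed
  have Gper: "periodic L (G t)" if "t \<in> J" for t
    using Bper that by (simp add: periodic_def G_eq)
  have GL2: "G t \<in> L2_sym L" and SL2: "S t \<in> L2_sym L" if "t \<in> J" for t
    using that by (auto intro!: continuous_in_L2_sym Gcont Gsym Scont Ssym)
  have Gzero: "G t x = 0" if "t \<in> J" "L2_norm L (G t) = 0" for t x
  proof (rule integral_square_eq_0_imp_eq_0[OF Gcont[OF that(1)] Gper[OF that(1)] L])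
    show "(LINT x|torus L. G t x \<bullet> G t x) = 0"
      using that(2) by (simp flip: L2_norm_square)
  qed
  have Gpos: "0 < L2_norm L (G t)" if "t \<in> J" "\<exists>x. G t x \<noteq> 0" for t
    using Gzero[OF that(1)] that(2) L2_norm_nonneg[of L "G t"] by (metis order_le_less)
  have adm: "AE t in lebesgue. t \<in> J \<longrightarrow> P t = 0 \<or> S t \<in> candidate_defects L \<alpha> (P t) (G t)"
    if "residual_matching_admissible L J \<nu> \<alpha> lam u p B"
    using that[unfolded residual_matching_admissible_def energy_entropy_admissible_def]
  proof eventually_elim
    case (elim t)
    show ?case
    proof
      assume t: "t \<in> J"
      have "(LINT x|torus L. - (R\<^sub>N t x :\<^sub>F symgrad (u t) x) + \<alpha> / 2 * (G t x :\<^sub>F S t x)) \<le> 0"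
        using elim t div0 by (simp add: frob_pressure_symgrad R\<^sub>N N G A S)
      then show "P t = 0 \<or> S t \<in> candidate_defects L \<alpha> (P t) (G t)"
        by (rule admissible_imp_candidate_defect) (use t GL2 SL2 in \<open>auto simp: P\<close>)
    qed
  qed
  have work: "max (P t) 0 \<le> \<alpha> / 2 * L2_norm L (G t) * L2_norm L (S t)"
    if "t \<in> J" "P t = 0 \<or> S t \<in> candidate_defects L \<alpha> (P t) (G t)" for t
    using positive_part_le_defect_work[OF GL2[OF that(1)] _ \<alpha> that(2)] Gzero[OF that(1)] by blast
  have i: "AE t in lebesgue. t \<in> J \<longrightarrow> max (P t) 0 \<le> \<alpha> / 2 * L2_norm L (G t) * L2_norm L (S t)"
    if "residual_matching_admissible L J \<nu> \<alpha> lam u p B"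
    using adm[OF that] by eventually_elim (use work in blast)
  have ii_bound: "AE t in lebesgue. t \<in> J \<longrightarrow> (\<exists>x. G t x \<noteq> 0) \<longrightarrow>
           2 * max (P t) 0 / (\<alpha> * L2_norm L (G t)) \<le> L2_norm L (S t)"
    if "residual_matching_admissible L J \<nu> \<alpha> lam u p B"
    using i[OF that] by eventually_elim (use Gpos \<alpha> in \<open>auto simp: field_simps\<close>)
  have iii: "AE t in lebesgue. t \<in> J \<longrightarrow> (\<forall>x. G t x = 0) \<longrightarrow> P t \<le> 0"
    if "residual_matching_admissible L J \<nu> \<alpha> lam u p B"
    using i[OF that] by eventually_elim (auto simp: L2_norm_def frob_eq_inner)
  have G_A: "(\<forall>x. G t x = 0) \<longleftrightarrow> (AE x in torus L. A t x = mat 1)" if t: "t \<in> J" for t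
  proof
    assume "\<forall>x. G t x = 0"
    then have "mexp (- B t x) = mat 1" for x by (simp add: G_eq)
    then have "A t x = mat 1" for x
      using mexp_mult_mexp_uminus[of "B t x"] by (simp add: A)
    then show "AE x in torus L. A t x = mat 1" by simp
  next
    assume "AE x in torus L. A t x = mat 1"
    then have "AE x in torus L. G t x \<bullet> G t x = 0"
    proof eventually_elim
      case (elim x)
      then have "mexp (- B t x) = mat 1"
        using mexp_mult_mexp_uminus[of "B t x"] by (simp add: A)
      then show ?case by (simp add: G_eq)
    qed
    then have "(LINT x|torus L. G t x \<bullet> G t x) = 0"
      by (rule integral_eq_zero_AE)
    from integral_square_eq_0_imp_eq_0[OF Gcont[OF t] Gper[OF t] L this]
    show "\<forall>x. G t x = 0" ..
  qed
  have min: "\<exists>T\<in>candidate_defects L \<alpha> (P t) (G t).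
           L2_norm L T = 2 * max (P t) 0 / (\<alpha> * L2_norm L (G t))"
    if t: "t \<in> J" "\<exists>x. G t x \<noteq> 0" for t
  proof (cases "0 \<le> P t")
    case True
    then show ?thesis
      using scaled_candidate_defect[OF GL2[OF t(1)] Gpos[OF t] \<alpha> True refl]
      by (metis max.absorb1)
  next
    case False
    have "(\<lambda>x. 0) \<in> candidate_defects L \<alpha> (P t) (G t)"
      using False by (simp add: candidate_defects_def frob_eq_inner L2_sym_def symmetric_def
          linear_0[OF bounded_linear.linear[OF bounded_linear_transpose]])
    moreover have "L2_norm L (\<lambda>x. 0) = 2 * max (P t) 0 / (\<alpha> * L2_norm L (G t))"
      using False by (simp add: L2_norm_def frob_eq_inner max_def)
    ultimately show ?thesis by blast
  qed
  have lower: "2 * max (P t) 0 / (\<alpha> * L2_norm L (G t)) \<le> L2_norm L T"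
    if t: "t \<in> J" "\<exists>x. G t x \<noteq> 0" and "T \<in> candidate_defects L \<alpha> (P t) (G t)" for t T
    using candidate_defect_norm_ge[OF GL2[OF t(1)] Gpos[OF t] \<alpha> that(3)] .
  have unique: "let S_min = (\<lambda>x. - (2 * P t / (\<alpha> * (L2_norm L (G t))\<^sup>2)) *\<^sub>R G t x) in
              (\<forall>x. symmetric (S_min x)) \<and>
              is_arg_min (L2_norm L) (\<lambda>T. T \<in> candidate_defects L \<alpha> (P t) (G t)) S_min \<and>
              (\<forall>T. is_arg_min (L2_norm L) (\<lambda>T. T \<in> candidate_defects L \<alpha> (P t) (G t)) T \<longrightarrow>
                 (AE x in torus L. T x = S_min x))"
    if t: "t \<in> J" "\<exists>x. G t x \<noteq> 0" and "0 < P t" for t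
  proof -
    define c where "c = 2 * P t / (\<alpha> * (L2_norm L (G t))\<^sup>2)"
    have Pt: "0 \<le> P t" using that(3) by simp
    note Smin = scaled_candidate_defect[OF GL2[OF t(1)] Gpos[OF t] \<alpha> Pt c_def]
    have "symmetric (- c *\<^sub>R G t x)" for x
      by (intro symmetric_scaleR Gsym t)
    moreover have "is_arg_min (L2_norm L) (\<lambda>T. T \<in> candidate_defects L \<alpha> (P t) (G t)) (\<lambda>x. - c *\<^sub>R G t x)"
      unfolding is_arg_min_def Smin(2) using Smin(1) lower[OF t] Pt
      by (auto simp: not_less max_def split: if_splits)
    moreover have "AE x in torus L. T x = - c *\<^sub>R G t x"
      if "is_arg_min (L2_norm L) (\<lambda>T. T \<in> candidate_defects L \<alpha> (P t) (G t)) T" for T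
    proof (rule minimal_defect_unique[OF GL2[OF t(1)] Gpos[OF t] \<alpha> Pt c_def])
      show "T \<in> candidate_defects L \<alpha> (P t) (G t)"
        using that by (simp add: is_arg_min_def)
      show "L2_norm L T \<le> 2 * P t / (\<alpha> * L2_norm L (G t))"
        using that Smin unfolding is_arg_min_def by (metis not_less)
    qed
    ultimately show ?thesis
      unfolding Let_def c_def[symmetric] by blast
  qed
  show ?thesis
    using Ssym Nmean i min lower unique ii_bound G_A iii by blast
qed

end
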